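(* Let $S,T,A,B$ be finite nonempty sets (a Bell scenario), let $N=|S||A|+|T||B|$, and let $p=(p(a,b|s,t))\in\mathbb{R}^{|A\times B\times S\times T|}$ be an arbitrary real vector. Then: (i) $p$ is a classical correlation (i.e. $p\in\mathcal{C}$) if and only if $p\in\mathrm{Corr}(\mathcal{CP}^N)$; (ii) $p$ is a quantum correlation (i.e. $p\in\mathcal{Q}$) if and only if $p\in\mathrm{Corr}(\mathcal{CS}_+^N)$; (iii) $p$ is a no-signaling correlation (i.e. $p\in\mathcal{NS}$) if and only if $p\in\mathrm{Corr}(\mathcal{NSO})$; (iv) $p$ is a correlation (i.e. $p\in\mathcal{P}$) if and only if $p\in\mathrm{Corr}(\mathcal{N}^N)$.
   Context: Correlation sets. $\mathcal{P}$ is the set of vectors $p=(p(a,b|s,t))_{a\in A,b\in B,s\in S,t\in T}$ with $p(a,b|s,t)\ge 0$ for all $a,b,s,t$ and $\sum_{a,b}p(a,b|s,t)=1$ for all $s,t$. $\mathcal{C}$ (classical): $p\in\mathcal P$ such that for some $n\ge1$ there are nonnegative reals $k_i,x_a^{s,i},y_b^{t,i}$ ($i\in[n]$) with $\sum_i k_i=1$, $\sum_a x_a^{s,i}=\sum_b y_b^{t,i}=1$ for all $s,t,i$, and $p(a,b|s,t)=\sum_{i=1}^n k_i x_a^{s,i}y_b^{t,i}$ for all $a,b,s,t$. $\mathcal{Q}$ (quantum): $p\in\mathcal P$ such that there are finite-dimensional complex Euclidean spaces $\mathcal X,\mathcal Y$, a unit vector $\psi\in\mathcal X\otimes\mathcal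 Y$, Hermitian positive semidefinite (psd) operators $\{X_a^s\}_{a\in A}$ on $\mathcal X$ with $\sum_a X_a^s=\mathbb I_{\mathcal X}$ for each $s\in S$, and Hermitian psd operators $\{Y_b^t\}_{b\in B}$ on $\mathcal Y$ with $\sum_b Y_b^t=\mathbb I_{\mathcal Y}$ for each $t\in T$, with $p(a,b|s,t)=\psi^*(X_a^s\otimes Y_b^t)\psi$ for all $a,b,s,t$. $\mathcal{NS}$ (no-signaling): $p\in\mathcal P$ with $\sum_b p(a,b|s,t)=\sum_b p(a,b|s,t')$ for all $a,s$, $t\neq t'$, and $\sum_a p(a,b|s,t)=\sum_a p(a,b|s',t)$ for all $b,t$, $s\ne s'$. Matrices. $\mathcal S^n$ is the space of real symmetric $n\times n$ matrices. Matrices in $\mathcal S^N$ have rows and columns indexed by the disjoint union of $S\times A$ and $T\times B$; in $S\cup T$ the sets $S$ and $T$ are regarded as disjoint. For $i,j\in S\cup T$ and $X\in\mathcal S^N$, $\langle J_{i,j},X\rangle:=\sum_{k,l}X[(i,k),(j,l)]$ is the sum of all entries in the $(i,j)$ block ($k$ ranges over $A$ if $i\in S$, over $B$ if $i\in T$; likewise $l$ and $j$). Cones. $\mathcal N^n$: entrywise nonnegative matrices in $\mathcal S^n$. $\mathcal{CP}^n$ (completely positive): matrices $(\langle x_i,x_j\rangle)_{i,j=1}^n$ with $x_1,\dots,x_n\in\mathbb R^d_+$ for some $d\ge1$. $\mathcal{CS}_+^n$ (completely positive semidefinite): matrices $(\mathrm{Tr}(X_iX_j))_{i,j=1}^n$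 with $X_1,\dots,X_n$ real symmetric psd $d\times d$ matrices for some $d\ge1$. $\mathcal{NSO}$: matrices $X\in\mathcal N^N$ with $\sum_{a\in A}X[(s,a),(t,b)]=\sum_{a\in A}X[(s',a),(t,b)]$ for all $b\in B,t\in T,s\neq s'\in S$, and $\sum_{b\in B}X[(s,a),(t,b)]=\sum_{b\in B}X[(s,a),(t',b)]$ for all $a\in A,s\in S,t\ne t'\in T$. $\mathcal K$-correlations. For a convex cone $\mathcal K\subseteq\mathcal N^N$, $\mathrm{Corr}(\mathcal K)$ is the set of vectors $p\in\mathbb{R}^{|A\times B\times S\times T|}$ for which there is $X\in\mathcal K$ with $\langle J_{i,j},X\rangle=1$ for all $i,j\in S\cup T$ and $X[(s,a),(t,b)]=p(a,b|s,t)$ for all $a,b,s,t$. *)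

theory Defs
  imports
    "HOL-Analysis.Finite_Cartesian_Product"
    "Jordan_Normal_Form.Schur_Decomposition"
begin

(* Both libraries write "$" for vector indexing; from here on "$" is the one for vectors of
   run-time dimension and "$h" the one for vectors indexed by a finite type. *)
no_notation vec_nth (infixl "$" 90)
notation vec_nth (infixl "$h" 90)

section \<open>Positive semidefinite matrices, trace and Kronecker product\<close>

(* For complex matrices the inequality is that of Complex_Order, so it also says that the
   quadratic form is real; for real matrices conjugation is the identity and the adjoint is the
   transpose (see psd_real_iff). *)
definition psd :: "nat \<Rightarrow> 'a::conjugatable_ordered_field mat \<Rightarrow> bool" where
  "psd d M \<longleftrightarrow> M \<in> carrier_mat d d \<and> mat_adjoint M = M \<and>
     (\<forall>v \<in> carrier_vec d. 0 \<le> (M *\<^sub>v v) \<bullet>c v)"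

lemma psd_real_iff:
  fixes M :: "real mat"
  shows "psd d M \<longleftrightarrow> M \<in> carrier_mat d d \<and> transpose_mat M = M \<and>
     (\<forall>v \<in> carrier_vec d. 0 \<le> v \<bullet> (M *\<^sub>v v))"
proof -
  have "mat_adjoint M = transpose_mat M"
    by (rule eq_matI) (auto simp: mat_adjoint_def mat_of_rows_def)
  moreover have "(M *\<^sub>v v) \<bullet>c v = v \<bullet> (M *\<^sub>v v)"
    if "M \<in> carrier_mat d d" "v \<in> carrier_vec d" for v
    using that by (simp add: comm_scalar_prod[of _ d])
  ultimately show ?thesis by (auto simp: psd_def)
qed

definition mat_trace :: "'a::comm_monoid_add mat \<Rightarrow> 'a" where
  "mat_trace M = (\<Sum>i<dim_row M. M $$ (i, i))"

(* The basis vector e_i \<otimes> f_j of the tensor product of spaces of dimensions m and n is the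
   basis vector number i * n + j of the space of dimension m * n. *)
definition kronecker :: "'a::times mat \<Rightarrow> 'a mat \<Rightarrow> 'a mat" where
  "kronecker M M' =
     Matrix.mat (dim_row M * dim_row M') (dim_col M * dim_col M')
       (\<lambda>(i, j). M $$ (i div dim_row M', j div dim_col M')
               * M' $$ (i mod dim_row M', j mod dim_col M'))"

(* The type of matrices is not an additive monoid, hence the entrywise sum. *)
definition measurement :: "nat \<Rightarrow> ('o::finite \<Rightarrow> complex mat) \<Rightarrow> bool" where
  "measurement d E \<longleftrightarrow>
     (\<forall>r. psd d (E r)) \<and> Matrix.mat d d (\<lambda>(i, j). \<Sum>r\<in>UNIV. E r $$ (i, j)) = 1\<^sub>m d"

section \<open>Correlation sets\<close>

(* p a b s t is p(a,b|s,t); the finite nonempty sets A, B, S, T of the Bell scenario are finite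
   types. *)
type_synonym ('a, 'b, 's, 't) corr = "'a \<Rightarrow> 'b \<Rightarrow> 's \<Rightarrow> 't \<Rightarrow> real"

definition correlations :: "('a::finite, 'b::finite, 's::finite, 't::finite) corr set" where
  "correlations =
     {p. (\<forall>a b s t. 0 \<le> p a b s t) \<and> (\<forall>s t. (\<Sum>a\<in>UNIV. \<Sum>b\<in>UNIV. p a b s t) = 1)}"

definition classical :: "('a::finite, 'b::finite, 's::finite, 't::finite) corr set" where
  "classical = {p \<in> correlations.
     \<exists>(n::nat) (k :: nat \<Rightarrow> real) (x :: 'a \<Rightarrow> 's \<Rightarrow> nat \<Rightarrow> real) (y :: 'b \<Rightarrow> 't \<Rightarrow> nat \<Rightarrow> real).
       n \<ge> 1 \<and>
       (\<forall>i<n. 0 \<le> k i) \<and> (\<forall>i<n. \<forall>a s. 0 \<le> x a s i) \<and> (\<forall>i<n. \<forall>b t. 0 \<le> y b t i) \<and>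
       (\<Sum>i<n. k i) = 1 \<and>
       (\<forall>i<n. \<forall>s. (\<Sum>a\<in>UNIV. x a s i) = 1) \<and> (\<forall>i<n. \<forall>t. (\<Sum>b\<in>UNIV. y b t i) = 1) \<and>
       (\<forall>a b s t. p a b s t = (\<Sum>i<n. k i * x a s i * y b t i))}"

definition quantum :: "('a::finite, 'b::finite, 's::finite, 't::finite) corr set" where
  "quantum = {p \<in> correlations.
     \<exists>(m::nat) (n::nat) (\<psi> :: complex vec)
       (X :: 's \<Rightarrow> 'a \<Rightarrow> complex mat) (Y :: 't \<Rightarrow> 'b \<Rightarrow> complex mat).
       \<psi> \<in> carrier_vec (m * n) \<and> \<psi> \<bullet>c \<psi> = 1 \<and>
       (\<forall>s. measurement m (X s)) \<and> (\<forall>t. measurement n (Y t)) \<and>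
       (\<forall>a b s t. complex_of_real (p a b s t) = (kronecker (X s a) (Y t b) *\<^sub>v \<psi>) \<bullet>c \<psi>)}"

definition no_signaling :: "('a::finite, 'b::finite, 's::finite, 't::finite) corr set" where
  "no_signaling = {p \<in> correlations.
     (\<forall>a s t t'. t \<noteq> t' \<longrightarrow> (\<Sum>b\<in>UNIV. p a b s t) = (\<Sum>b\<in>UNIV. p a b s t')) \<and>
     (\<forall>b t s s'. s \<noteq> s' \<longrightarrow> (\<Sum>a\<in>UNIV. p a b s t) = (\<Sum>a\<in>UNIV. p a b s' t))}"

section \<open>Matrix cones\<close>

definition sym_matrices :: "(real ^ 'n ^ 'n) set" where
  "sym_matrices = {X. Finite_Cartesian_Product.transpose X = X}"

definition nonneg_cone :: "(real ^ 'n ^ 'n) set" where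
  "nonneg_cone = {X \<in> sym_matrices. \<forall>i j. 0 \<le> X $h i $h j}"

definition cp_cone :: "(real ^ 'n ^ 'n) set" where
  "cp_cone = {X. \<exists>d\<ge>1. \<exists>x :: 'n \<Rightarrow> real vec.
     (\<forall>i. x i \<in> carrier_vec d \<and> (\<forall>k<d. 0 \<le> x i $ k)) \<and> X = (\<chi> i j. x i \<bullet> x j)}"

definition cpsd_cone :: "(real ^ 'n ^ 'n) set" where
  "cpsd_cone = {X. \<exists>d\<ge>1. \<exists>M :: 'n \<Rightarrow> real mat.
     (\<forall>i. psd d (M i)) \<and> X = (\<chi> i j. mat_trace (M i * M j))}"

(* Rows and columns are indexed by the disjoint union of S x A and T x B. *)
type_synonym ('a, 'b, 's, 't) bell_matrix =
  "real ^ (('s \<times> 'a) + ('t \<times> 'b)) ^ (('s \<times> 'a) + ('t \<times> 'b))"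

definition nso_cone :: "('a::finite, 'b::finite, 's::finite, 't::finite) bell_matrix set" where
  "nso_cone = {X \<in> nonneg_cone.
     (\<forall>b t s s'. s \<noteq> s' \<longrightarrow>
        (\<Sum>a\<in>UNIV. X $h Inl (s, a) $h Inr (t, b)) = (\<Sum>a\<in>UNIV. X $h Inl (s', a) $h Inr (t, b))) \<and>
     (\<forall>a s t t'. t \<noteq> t' \<longrightarrow>
        (\<Sum>b\<in>UNIV. X $h Inl (s, a) $h Inr (t, b)) = (\<Sum>b\<in>UNIV. X $h Inl (s, a) $h Inr (t', b)))}"

section \<open>Correlations generated by a cone\<close>

fun block :: "'s + 't \<Rightarrow> (('s \<times> 'a) + ('t \<times> 'b)) set" where
  "block (Inl s) = range (\<lambda>a. Inl (s, a))"
| "block (Inr t) = range (\<lambda>b. Inr (t, b))"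

(* The inner product of X with J_{i,j}. *)
definition block_sum ::
  "'s + 't \<Rightarrow> 's + 't \<Rightarrow> ('a::finite, 'b::finite, 's::finite, 't::finite) bell_matrix \<Rightarrow> real" where
  "block_sum i j X = (\<Sum>k\<in>block i. \<Sum>l\<in>block j. X $h k $h l)"

definition Corr ::
  "('a::finite, 'b::finite, 's::finite, 't::finite) bell_matrix set \<Rightarrow> ('a, 'b, 's, 't) corr set" where
  "Corr K = {p. \<exists>X\<in>K. (\<forall>i j. block_sum i j X = 1) \<and>
     (\<forall>a b s t. X $h Inl (s, a) $h Inr (t, b) = p a b s t)}"

end

theory Submission
  imports Defs "Jordan_Normal_Form.Spectral_Radius"
begin

text \<open>
  If all block sums of a Gram matrix are 1, then the sums of the Gram vectors over the blocks have
  pairwise inner product 1, so they all equal one unit vector. For completely positive matrices this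
  vector \<open>u\<close> has nonnegative entries; the squares of its entries are the weights of the
  classical mixture, and dividing the Gram vectors entrywise by \<open>u\<close> gives the local
  distributions.

  For completely positive semidefinite matrices the common block sum is a positive semidefinite
  \<open>K\<close> with \<open>Tr K\<^sup>2 = 1\<close>. In a basis in which \<open>K\<close> is diagonal, the operators
  \<open>K\<^sup>-\<^sup>1\<^sup>/\<^sup>2 M K\<^sup>-\<^sup>1\<^sup>/\<^sup>2\<close> (one side transposed), completed on the kernel of \<open>K\<close>, are
  measurements that generate the correlation from the state with coefficient matrix \<open>K\<close>.
  Conversely, if \<open>\<Psi>\<close> is the coefficient matrix of \<open>\<psi>\<close>, then
  \<open>\<psi>\<^sup>*(X \<otimes> Y)\<psi> = Tr(X \<Psi> Y\<^sup>T \<Psi>\<^sup>*)\<close>. After diagonalising \<open>\<Psi> \<Psi>\<^sup>* = K\<^sup>2\<close>, the matrices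
  \<open>K\<^sup>1\<^sup>/\<^sup>2 X K\<^sup>1\<^sup>/\<^sup>2\<close> and \<open>K\<^sup>-\<^sup>1\<^sup>/\<^sup>2 \<Psi> Y\<^sup>T \<Psi>\<^sup>* K\<^sup>-\<^sup>1\<^sup>/\<^sup>2\<close> have block sums \<open>K\<close>; they become real
  symmetric by replacing a complex number by a real 2 by 2 block.
\<close>

section \<open>Adjoints and positive semidefinite matrices\<close>

lemma dim_mat_adjoint [simp]:
  "dim_row (mat_adjoint A) = dim_col A" "dim_col (mat_adjoint A) = dim_row A"
  by (auto simp: mat_adjoint_def)

lemma mat_adjoint_carrier [simp]:
  "A \<in> carrier_mat n m \<Longrightarrow> mat_adjoint A \<in> carrier_mat m n"
  by (auto intro!: carrier_matI)

lemma index_mat_adjoint [simp]: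
  "i < dim_col A \<Longrightarrow> j < dim_row A \<Longrightarrow> mat_adjoint A $$ (i, j) = conjugate (A $$ (j, i))"
  by (simp add: mat_adjoint_def mat_of_rows_index)

lemma mat_adjoint_adjoint [simp]: "mat_adjoint (mat_adjoint A) = A"
  by (rule eq_matI) auto

lemma index_mult_mat_sum:
  assumes "A \<in> carrier_mat n m" "B \<in> carrier_mat m k" "i < n" "j < k"
  shows "(A * B) $$ (i, j) = (\<Sum>l<m. A $$ (i, l) * B $$ (l, j))"
  using assms by (auto simp: scalar_prod_def atLeast0LessThan)

lemma mat_adjoint_mult:
  fixes A B :: "'a::conjugatable_field mat"
  assumes "A \<in> carrier_mat n m" "B \<in> carrier_mat m k"
  shows "mat_adjoint (A * B) = mat_adjoint B * mat_adjoint A"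
proof (rule eq_matI)
  fix i j assume "i < dim_row (mat_adjoint B * mat_adjoint A)" "j < dim_col (mat_adjoint B * mat_adjoint A)"
  then have i: "i < k" and j: "j < n" using assms by auto
  have "mat_adjoint (A * B) $$ (i, j) = conjugate (\<Sum>l<m. A $$ (j, l) * B $$ (l, i))"
    using i j assms by (subst index_mat_adjoint) (simp_all add: index_mult_mat_sum[OF assms j i] del: index_mult_mat(1))
  also have "\<dots> = (\<Sum>l<m. mat_adjoint B $$ (i, l) * mat_adjoint A $$ (l, j))"
    using i j assms by (simp add: sum_conjugate conjugate_dist_mul mult.commute)
  also have "\<dots> = (mat_adjoint B * mat_adjoint A) $$ (i, j)"
    by (rule index_mult_mat_sum[symmetric]) (use assms i j in auto)
  finally show "mat_adjoint (A * B) $$ (i, j) = (mat_adjoint B * mat_adjoint A) $$ (i, j)" .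
qed (use assms in auto)

text \<open>Conjugation is multiplicative, so \<open>conjugate 1\<close> is a nonzero idempotent and
  can be cancelled.\<close>

lemma conjugate_one [simp]: "conjugate (1::'a::conjugatable_field) = 1"
proof -
  have "conjugate (1::'a) * conjugate 1 = conjugate 1 * 1"
    by (simp flip: conjugate_dist_mul)
  then show ?thesis by (metis conjugate_zero_iff mult_cancel_left zero_neq_one)
qed

lemma form_eq_sum:
  fixes M :: "'a::conjugatable_field mat"
  assumes "M \<in> carrier_mat n m" "v \<in> carrier_vec m" "w \<in> carrier_vec n"
  shows "(M *\<^sub>v v) \<bullet>c w = (\<Sum>i<n. \<Sum>j<m. M $$ (i, j) * v $ j * conjugate (w $ i))"
  using assms
  by (auto simp: scalar_prod_def atLeast0LessThan sum_distrib_right intro!: sum.cong)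

lemma mult_mat_vec_cscalar_prod:
  fixes M :: "'a::conjugatable_field mat"
  assumes "M \<in> carrier_mat n m" "v \<in> carrier_vec m" "w \<in> carrier_vec n"
  shows "(M *\<^sub>v v) \<bullet>c w = v \<bullet>c (mat_adjoint M *\<^sub>v w)"
proof -
  have "v \<bullet>c (mat_adjoint M *\<^sub>v w) = (\<Sum>j<m. \<Sum>i<n. M $$ (i, j) * v $ j * conjugate (w $ i))"
    using assms by (auto simp: scalar_prod_def atLeast0LessThan sum_distrib_left sum_conjugate
        conjugate_dist_mul mult_ac intro!: sum.cong)
  also have "\<dots> = (\<Sum>i<n. \<Sum>j<m. M $$ (i, j) * v $ j * conjugate (w $ i))"
    by (rule sum.swap)
  finally show ?thesis by (simp add: form_eq_sum[OF assms])
qed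

lemma psd_carrier [simp]: "psd d M \<Longrightarrow> M \<in> carrier_mat d d"
  by (simp add: psd_def)

lemma psd_conjugate_entry:
  "psd d M \<Longrightarrow> i < d \<Longrightarrow> j < d \<Longrightarrow> conjugate (M $$ (j, i)) = M $$ (i, j)"
  unfolding psd_def by (metis carrier_matD index_mat_adjoint)

text \<open>Coordinate form of positivity. The test vector is an arbitrary function on indices, so
  it can be rescaled or conjugated without dimension bookkeeping.\<close>

lemma psd_iff_sum:
  "psd d M \<longleftrightarrow> M \<in> carrier_mat d d \<and> (\<forall>i<d. \<forall>j<d. conjugate (M $$ (j, i)) = M $$ (i, j)) \<and>
     (\<forall>v. 0 \<le> (\<Sum>i<d. \<Sum>j<d. M $$ (i, j) * v j * conjugate (v i)))"
  (is "_ \<longleftrightarrow> ?C \<and> ?H \<and> ?P")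
proof
  assume L: "psd d M"
  show "?C \<and> ?H \<and> ?P"
  proof (intro conjI allI impI)
    fix v
    have "0 \<le> (M *\<^sub>v Matrix.vec d v) \<bullet>c Matrix.vec d v"
      using L by (simp add: psd_def)
    then show "0 \<le> (\<Sum>i<d. \<Sum>j<d. M $$ (i, j) * v j * conjugate (v i))"
      using L by (simp add: form_eq_sum[of M d d])
  qed (use L in \<open>auto simp: psd_conjugate_entry\<close>)
next
  assume R: "?C \<and> ?H \<and> ?P"
  then have "mat_adjoint M = M" by (intro eq_matI) auto
  moreover have "0 \<le> (M *\<^sub>v v) \<bullet>c v" if "v \<in> carrier_vec d" for v
    unfolding form_eq_sum[OF conjunct1[OF R] that that] using R by blast
  ultimately show "psd d M" using R by (simp add: psd_def)
qed

text \<open>Associativity only. It lets changes of basis be composed, both in the induction for the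
  spectral theorem and when a coefficient matrix is combined with a diagonalising unitary.\<close>

lemma congruence_mult:
  fixes A :: "'a::conjugatable_field mat"
  assumes A: "A \<in> carrier_mat n n" and U: "U \<in> carrier_mat n m" and W: "W \<in> carrier_mat m k"
  shows "mat_adjoint (U * W) * A * (U * W) = mat_adjoint W * (mat_adjoint U * A * U) * W"
proof -
  note c = A U W mat_adjoint_carrier[OF U] mat_adjoint_carrier[OF W]
  note c = c mult_carrier_mat[OF c(5,4)] mult_carrier_mat[OF c(4,1)] mult_carrier_mat[OF c(2,3)]
    mult_carrier_mat[OF c(1,2)]
  note c = c mult_carrier_mat[OF c(4,9)] mult_carrier_mat[OF c(9,3)]
  show ?thesis
    unfolding mat_adjoint_mult[OF U W] assoc_mult_mat[OF c(5,4,1)]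
      assoc_mult_mat[OF c(5) c(7) c(8)] assoc_mult_mat[OF c(4,1,8)]
      assoc_mult_mat[OF c(4,1,2)] assoc_mult_mat[OF c(5,10,3)] assoc_mult_mat[OF c(4,9,3)]
      assoc_mult_mat[OF c(1,2,3)] ..
qed

lemma hermitian_congruence:
  fixes A C :: "'a::conjugatable_field mat"
  assumes "A \<in> carrier_mat d d" "mat_adjoint A = A" "C \<in> carrier_mat d n"
  shows "mat_adjoint (mat_adjoint C * A * C) = mat_adjoint C * A * C"
  using assms by (simp add: mat_adjoint_mult[of _ n d _ n] mat_adjoint_mult[of _ d d _ n]
      mult_carrier_mat[of _ d d _ n] assoc_mult_mat[of _ n d _ d _ n])

text \<open>The form of the congruent matrix at \<open>v\<close> is the form of \<open>M\<close> at
  \<open>C *\<^sub>v v\<close>.\<close>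

lemma psd_congruence:
  assumes M: "psd d M" and C: "C \<in> carrier_mat d n"
  shows "psd n (mat_adjoint C * M * C)"
proof -
  have "mat_adjoint (mat_adjoint C * M * C) = mat_adjoint C * M * C"
    using M C by (intro hermitian_congruence) (auto simp: psd_def)
  moreover have "0 \<le> (mat_adjoint C * M * C *\<^sub>v v) \<bullet>c v" if v: "v \<in> carrier_vec n" for v
  proof -
    have "(mat_adjoint C * M * C *\<^sub>v v) \<bullet>c v = (mat_adjoint C *\<^sub>v (M *\<^sub>v (C *\<^sub>v v))) \<bullet>c v"
      using C v psd_carrier[OF M] by (simp add: assoc_mult_mat_vec[of _ n d _ n] assoc_mult_mat_vec[of _ n d _ d]
          mult_carrier_mat[of _ n d _ d] mult_mat_vec_carrier[of _ d n] mult_mat_vec_carrier[of _ d d])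
    also have "\<dots> = (M *\<^sub>v (C *\<^sub>v v)) \<bullet>c (C *\<^sub>v v)"
      using C v psd_carrier[OF M] by (subst mult_mat_vec_cscalar_prod[of _ n d])
        (auto simp: mult_mat_vec_carrier[of _ d n] mult_mat_vec_carrier[of _ d d])
    moreover have "C *\<^sub>v v \<in> carrier_vec d" using C v by simp
    ultimately show ?thesis using M by (simp add: psd_def)
  qed
  moreover have "mat_adjoint C * M * C \<in> carrier_mat n n"
    using C by (intro carrier_matI) auto
  ultimately show ?thesis by (simp add: psd_def)
qed

lemma psd_one [simp]: "psd d (1\<^sub>m d :: 'a::conjugatable_ordered_field mat)"
proof -
  have "mat_adjoint (1\<^sub>m d :: 'a mat) = 1\<^sub>m d"
    by (rule eq_matI) auto
  then show ?thesis by (auto simp: psd_def)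
qed

text \<open>A diagonal entry is the value of the quadratic form at a standard basis vector.\<close>

lemma psd_diag_nonneg:
  fixes M :: "'a::conjugatable_ordered_field mat"
  assumes "psd d M" "i < d"
  shows "0 \<le> M $$ (i, i)"
proof -
  define e where "e l = (if l = i then 1 else (0::'a))" for l
  have "0 \<le> (\<Sum>k<d. \<Sum>l<d. M $$ (k, l) * e l * conjugate (e k))"
    using assms unfolding psd_iff_sum by blast
  also have "\<dots> = (\<Sum>k<d. \<Sum>l<d. if l = i then if k = i then M $$ (i, i) else 0 else 0)"
    by (intro sum.cong refl) (simp add: e_def)
  finally show ?thesis using assms by simp
qed

section \<open>The spectral theorem\<close>

text \<open>Complete \<open>v\<close> to a basis and orthogonalise: Gram-Schmidt leaves the first
  vector unchanged, so only its length is altered by the normalisation.\<close>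

lemma unitary_with_first_column:
  fixes v :: "complex vec"
  assumes v: "v \<in> carrier_vec n" and v0: "v \<noteq> 0\<^sub>v n"
  shows "\<exists>U\<in>carrier_mat n n. mat_adjoint U * U = 1\<^sub>m n \<and> (\<exists>c. col U 0 = c \<cdot>\<^sub>v v)"
proof -
  interpret cof_vec_space n "TYPE(complex)" .
  define b where "b = basis_completion v"
  define ws where "ws = gram_schmidt n b"
  from basis_completion[OF v v0, folded b_def]
  have b: "distinct b" "\<not> lin_dep (set b)" "set b \<subseteq> carrier_vec n" "hd b = v" "length b = n"
    by auto
  from gram_schmidt_result[OF b(3,1,2) refl, folded ws_def]
  have ws: "set ws \<subseteq> carrier_vec n" "corthogonal ws" "length ws = n" by (auto simp: b)
  have n: "n > 0" using v v0 by (intro gr0I) auto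
  then obtain vs where "b = v # vs" using b by (cases b) auto
  then have "hd ws = v" using gram_schmidt_hd[OF v, of vs] by (simp add: ws_def)
  then have ws0: "ws ! 0 = v" using n ws by (cases ws) auto
  have wsc: "ws ! j \<in> carrier_vec n" if "j < n" for j using ws that by (auto simp: set_conv_nth)
  \<comment> \<open>The vectors \<open>ws\<close> are orthogonal but not normalised;
    \<open>r j\<close> is the length to divide by.\<close>
  define r where "r j = sqrt (Re (ws ! j \<bullet>c ws ! j))" for j
  have rr: "ws ! j \<bullet>c ws ! j = complex_of_real (r j * r j)" and r0: "r j \<noteq> 0" if "j < n" for j
  proof -
    have "0 \<le> ws ! j \<bullet>c ws ! j" by auto
    moreover have "ws ! j \<bullet>c ws ! j \<noteq> 0" using ws that corthogonalD[of ws j j] by auto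
    ultimately show "ws ! j \<bullet>c ws ! j = complex_of_real (r j * r j)" "r j \<noteq> 0"
      by (auto simp: r_def less_eq_complex_def complex_eq_iff)
  qed
  define U where "U = Matrix.mat n n (\<lambda>(i, j). (ws ! j) $ i / complex_of_real (r j))"
  have U: "U \<in> carrier_mat n n" by (simp add: U_def)
  have "mat_adjoint U * U = 1\<^sub>m n"
  proof (rule eq_matI)
    fix i j assume "i < dim_row (1\<^sub>m n :: complex mat)" "j < dim_col (1\<^sub>m n :: complex mat)"
    then have ij: "i < n" "j < n" by auto
    have "(mat_adjoint U * U) $$ (i, j)
        = (\<Sum>l<n. mat_adjoint U $$ (i, l) * U $$ (l, j))"
      using U ij by (intro index_mult_mat_sum) auto
    also have "\<dots> = (\<Sum>l<n. (ws ! j) $ l * cnj ((ws ! i) $ l)) / (complex_of_real (r j) * complex_of_real (r i))"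
      using ij by (auto simp: U_def sum_divide_distrib mult_ac intro!: sum.cong)
    also have "(\<Sum>l<n. (ws ! j) $ l * cnj ((ws ! i) $ l)) = ws ! j \<bullet>c ws ! i"
      using wsc[OF ij(1)] wsc[OF ij(2)] by (auto simp: scalar_prod_def atLeast0LessThan)
    also have "\<dots> / (complex_of_real (r j) * complex_of_real (r i)) = 1\<^sub>m n $$ (i, j)"
    proof (cases "i = j")
      case True
      then show ?thesis using ij rr r0 by simp
    next
      case False
      then have "ws ! j \<bullet>c ws ! i = 0" using ws ij corthogonalD[of ws j i] by auto
      then show ?thesis using False ij by simp
    qed
    finally show "(mat_adjoint U * U) $$ (i, j) = 1\<^sub>m n $$ (i, j)" .
  qed (use U in auto)
  moreover have "col U 0 = (1 / complex_of_real (r 0)) \<cdot>\<^sub>v v"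
    using n v ws0 by (intro eq_vecI) (auto simp: U_def)
  ultimately show ?thesis using U by blast
qed

text \<open>Deflation, by induction on the dimension: with an eigenvector as first basis vector, the
  first column vanishes below the diagonal, and so does the first row because the matrix stays
  Hermitian. The remaining block is diagonalised by the induction hypothesis.\<close>

lemma hermitian_diagonalization:
  fixes A :: "complex mat"
  assumes "A \<in> carrier_mat n n" "mat_adjoint A = A"
  shows "\<exists>U\<in>carrier_mat n n. mat_adjoint U * U = 1\<^sub>m n \<and>
           (\<forall>i<n. \<forall>j<n. i \<noteq> j \<longrightarrow> (mat_adjoint U * A * U) $$ (i, j) = 0)"
  using assms
proof (induction n arbitrary: A)
  case 0
  then show ?case by (intro bexI[of _ "1\<^sub>m 0"]) auto
next
  case (Suc n)
  note A = Suc.prems(1)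
  obtain e v where ev: "v \<in> carrier_vec (Suc n)" "v \<noteq> 0\<^sub>v (Suc n)" "A *\<^sub>v v = e \<cdot>\<^sub>v v"
    using spectrum_non_empty[OF A] A by (auto simp: spectrum_def eigenvalue_def eigenvector_def)
  obtain U c where U: "U \<in> carrier_mat (Suc n) (Suc n)" and UU: "mat_adjoint U * U = 1\<^sub>m (Suc n)"
    and col: "col U 0 = c \<cdot>\<^sub>v v"
    using unitary_with_first_column[OF ev(1,2)] by blast
  define B where "B = mat_adjoint U * A * U"
  have B: "B \<in> carrier_mat (Suc n) (Suc n)" using U A by (intro carrier_matI) (auto simp: B_def)
  have Bh: "mat_adjoint B = B" unfolding B_def by (rule hermitian_congruence[OF A Suc.prems(2) U])
  have Acol: "A *\<^sub>v col U 0 = e \<cdot>\<^sub>v col U 0"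
    using A ev by (simp add: col mult_mat_vec[of _ "Suc n" "Suc n"] smult_smult_assoc mult.commute)
  \<comment> \<open>The first column of \<open>U\<close> is an eigenvector, so this entry is
    \<open>e\<close> times an off-diagonal entry of the identity
    \<open>mat_adjoint U * U\<close>.\<close>
  have B0: "B $$ (i, 0) = 0" if "0 < i" "i < Suc n" for i
  proof -
    have "B $$ (i, 0) = (mat_adjoint U * (A * U)) $$ (i, 0)"
      using U A by (simp del: index_mult_mat(1) add: B_def assoc_mult_mat[of _ "Suc n" "Suc n" _ "Suc n" _ "Suc n"])
    also have "\<dots> = Matrix.row (mat_adjoint U) i \<bullet> (A *\<^sub>v col U 0)"
      unfolding col_mult2[OF A U zero_less_Suc, symmetric] using U A that by (intro index_mult_mat) auto
    also have "\<dots> = e * (mat_adjoint U * U) $$ (i, 0)"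
      using U that by (simp add: Acol)
    finally show ?thesis using that by (simp add: UU)
  qed
  have B0': "B $$ (0, i) = 0" if "0 < i" "i < Suc n" for i
    using arg_cong[OF Bh, of "\<lambda>M. M $$ (0, i)"] B0[OF that] that B by simp
  define C where "C = Matrix.mat n n (\<lambda>(i, j). B $$ (Suc i, Suc j))"
  have C: "C \<in> carrier_mat n n" by (simp add: C_def)
  have "mat_adjoint C = C"
  proof (rule eq_matI)
    fix i j assume "i < dim_row C" "j < dim_col C"
    then show "mat_adjoint C $$ (i, j) = C $$ (i, j)"
      using arg_cong[OF Bh, of "\<lambda>M. M $$ (Suc i, Suc j)"] B by (simp add: C_def)
  qed (auto simp: C_def)
  from Suc.IH[OF C this] obtain V where V: "V \<in> carrier_mat n n" and VV: "mat_adjoint V * V = 1\<^sub>m n"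
    and dV: "\<And>i j. i < n \<Longrightarrow> j < n \<Longrightarrow> i \<noteq> j \<Longrightarrow> (mat_adjoint V * C * V) $$ (i, j) = 0"
    by blast
  \<comment> \<open>The unitary of the smaller block, extended by the identity on the eigenvector;
    the diagonalising unitary is \<open>U * W\<close>.\<close>
  define W where "W = four_block_mat (1\<^sub>m 1) (0\<^sub>m 1 n) (0\<^sub>m n 1) V"
  have W: "W \<in> carrier_mat (Suc n) (Suc n)"
    using four_block_carrier_mat[of "1\<^sub>m 1" 1 1 V n n] V by (simp add: W_def)
  have VCV: "mat_adjoint V * C * V \<in> carrier_mat n n"
    using V C by (intro carrier_matI) auto
  have Wa: "mat_adjoint W = four_block_mat (1\<^sub>m 1) (0\<^sub>m 1 n) (0\<^sub>m n 1) (mat_adjoint V)"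
    using V by (intro eq_matI) (auto simp: W_def)
  define b where "b = Matrix.mat 1 1 (\<lambda>_. B $$ (0, 0))"
  have b: "b \<in> carrier_mat 1 1" by (simp add: b_def)
  have Bb: "B = four_block_mat b (0\<^sub>m 1 n) (0\<^sub>m n 1) C"
    using B B0 B0' by (intro eq_matI) (auto simp: C_def b_def)
  have "mat_adjoint W * W = 1\<^sub>m (Suc n)"
    unfolding Wa unfolding W_def using V VV
    by (subst mult_four_block_mat[of _ 1 1 _ n _ n _ _ 1 _ n])
      (auto simp: four_block_one_mat[of 1 n, simplified])
  moreover have WBW: "mat_adjoint W * B * W =
      four_block_mat b (0\<^sub>m 1 n) (0\<^sub>m n 1) (mat_adjoint V * C * V)"
  proof -
    have VC: "mat_adjoint V * C \<in> carrier_mat n n" using V C by (intro carrier_matI) auto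
    have "mat_adjoint W * B = four_block_mat b (0\<^sub>m 1 n) (0\<^sub>m n 1) (mat_adjoint V * C)"
      unfolding Wa Bb using V C b VC
      by (subst mult_four_block_mat[of _ 1 1 _ n _ n _ _ 1 _ n]) auto
    then show ?thesis
      unfolding W_def using V b VC VCV
      by (simp only:) (subst mult_four_block_mat[of _ 1 1 _ n _ n _ _ 1 _ n], auto)
  qed
  moreover have "(mat_adjoint W * B * W) $$ (i, j) = 0" if "i < Suc n" "j < Suc n" "i \<noteq> j" for i j
    unfolding WBW using that V C b dV[of "i - 1" "j - 1"] by (auto simp del: index_mult_mat(1))
  \<comment> \<open>Unitarity of the product is the congruence rule applied to the identity
    matrix.\<close>
  moreover have "mat_adjoint (U * W) * (U * W) = mat_adjoint W * W"
    using congruence_mult[OF one_carrier_mat U W] U W UU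
    by (simp add: right_mult_one_mat[of _ "Suc n" "Suc n"] mat_adjoint_mult[of _ "Suc n" "Suc n" _ "Suc n"]
        mult_carrier_mat[of _ "Suc n" "Suc n" _ "Suc n"])
  moreover have "mat_adjoint (U * W) * A * (U * W) = mat_adjoint W * B * W"
    unfolding B_def by (rule congruence_mult[OF A U W])
  ultimately show ?case
    using mult_carrier_mat[OF U W] by (intro bexI[of _ "U * W"]) auto
qed

lemma psd_diagonalization:
  fixes M :: "complex mat"
  assumes M: "psd d M"
  shows "\<exists>V D. V \<in> carrier_mat d d \<and> mat_adjoint V * V = 1\<^sub>m d \<and> V * mat_adjoint V = 1\<^sub>m d \<and>
    (\<forall>i. 0 \<le> D i) \<and>
    mat_adjoint V * M * V = Matrix.mat d d (\<lambda>(i, j). if i = j then complex_of_real (D i) else 0)"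
proof -
  from M obtain V where V: "V \<in> carrier_mat d d" and VV: "mat_adjoint V * V = 1\<^sub>m d"
    and off: "\<And>i j. i < d \<Longrightarrow> j < d \<Longrightarrow> i \<noteq> j \<Longrightarrow> (mat_adjoint V * M * V) $$ (i, j) = 0"
    using hermitian_diagonalization[of M d] by (auto simp: psd_def)
  have P: "psd d (mat_adjoint V * M * V)" by (rule psd_congruence[OF M V])
  \<comment> \<open>The value 0 outside the matrix makes \<open>D\<close> nonnegative at every
    index, so later uses need no bound.\<close>
  define D where "D i = (if i < d then Re ((mat_adjoint V * M * V) $$ (i, i)) else 0)" for i
  show ?thesis
  proof (intro exI[of _ V] exI[of _ D] conjI allI V VV)
    show "V * mat_adjoint V = 1\<^sub>m d"
      by (rule mat_mult_left_right_inverse[OF _ V VV]) (use V in simp)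
    show "0 \<le> D i" for i
      using psd_diag_nonneg[OF P, of i] by (auto simp: D_def less_eq_complex_def)
    show "mat_adjoint V * M * V = Matrix.mat d d (\<lambda>(i, j). if i = j then complex_of_real (D i) else 0)"
    proof (rule eq_matI)
      fix i j assume "i < dim_row (Matrix.mat d d (\<lambda>(i, j). if i = j then complex_of_real (D i) else 0))"
        "j < dim_col (Matrix.mat d d (\<lambda>(i, j). if i = j then complex_of_real (D i) else 0))"
      then show "(mat_adjoint V * M * V) $$ (i, j) =
          Matrix.mat d d (\<lambda>(i, j). if i = j then complex_of_real (D i) else 0) $$ (i, j)"
        using off[of i j] psd_diag_nonneg[OF P, of i]
        by (auto simp: D_def less_eq_complex_def complex_eq_iff simp del: index_mult_mat(1))
    qed (use V in auto)
  qed
qed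

section \<open>Constructions preserving positivity\<close>

lemma psd_form_nonneg:
  "psd d M \<Longrightarrow> 0 \<le> (\<Sum>i<d. \<Sum>j<d. M $$ (i, j) * v j * conjugate (v i))"
  by (simp add: psd_iff_sum)

text \<open>The transposed form at \<open>v\<close> is the original form at the conjugate of
  \<open>v\<close>.\<close>

lemma psd_transpose:
  fixes M :: "'a::conjugatable_ordered_field mat"
  assumes "psd d M"
  shows "psd d (transpose_mat M)"
  unfolding psd_iff_sum
proof (intro conjI allI impI)
  show "transpose_mat M \<in> carrier_mat d d" using assms by simp
  show "conjugate (transpose_mat M $$ (j, i)) = transpose_mat M $$ (i, j)" if "i < d" "j < d" for i j
    using assms that psd_conjugate_entry[OF assms that(2,1)] by (auto dest!: psd_carrier)
  fix v :: "nat \<Rightarrow> 'a"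
  have "0 \<le> (\<Sum>i<d. \<Sum>j<d. M $$ (i, j) * conjugate (v j) * conjugate (conjugate (v i)))"
    by (rule psd_form_nonneg[OF assms, of "\<lambda>i. conjugate (v i)"])
  also have "\<dots> = (\<Sum>j<d. \<Sum>i<d. M $$ (i, j) * conjugate (v j) * conjugate (conjugate (v i)))"
    by (rule sum.swap)
  also have "\<dots> = (\<Sum>i<d. \<Sum>j<d. transpose_mat M $$ (i, j) * v j * conjugate (v i))"
    using psd_carrier[OF assms] by (intro sum.cong refl) (simp add: mult_ac)
  finally show "0 \<le> (\<Sum>i<d. \<Sum>j<d. transpose_mat M $$ (i, j) * v j * conjugate (v i))" .
qed

text \<open>This is congruence with the real diagonal matrix with entries \<open>e\<close>, carried
  out as the substitution of \<open>e i * v i\<close> for \<open>v i\<close>.\<close>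

lemma psd_scale:
  fixes M :: "complex mat" and e :: "nat \<Rightarrow> real"
  assumes "psd d M"
  shows "psd d (Matrix.mat d d (\<lambda>(i, j). complex_of_real (e i) * M $$ (i, j) * complex_of_real (e j)))"
  unfolding psd_iff_sum
proof (intro conjI allI impI, goal_cases)
  case (2 i j)
  then show ?case using psd_conjugate_entry[OF assms 2] by (simp add: mult_ac)
next
  case (3 v)
  have "0 \<le> (\<Sum>i<d. \<Sum>j<d. M $$ (i, j) * (e j * v j) * conjugate (e i * v i))"
    by (rule psd_form_nonneg[OF assms, of "\<lambda>i. complex_of_real (e i) * v i"])
  then show ?case by (simp add: mult_ac)
qed simp

lemma psd_sum:
  fixes M :: "'k \<Rightarrow> 'a::conjugatable_ordered_field mat"
  assumes "finite I" "\<And>k. k \<in> I \<Longrightarrow> psd d (M k)"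
  shows "psd d (Matrix.mat d d (\<lambda>(i, j). \<Sum>k\<in>I. M k $$ (i, j)))"
  unfolding psd_iff_sum
proof (intro conjI allI impI, goal_cases)
  case (2 i j)
  then show ?case using assms(1) psd_conjugate_entry[OF assms(2) 2]
    by (auto simp: sum_conjugate intro!: sum.cong)
next
  case (3 v)
  have "0 \<le> (\<Sum>k\<in>I. \<Sum>i<d. \<Sum>j<d. M k $$ (i, j) * v j * conjugate (v i))"
    by (intro sum_nonneg psd_form_nonneg assms(2))
  also have "\<dots> = (\<Sum>i<d. \<Sum>k\<in>I. \<Sum>j<d. M k $$ (i, j) * v j * conjugate (v i))"
    by (rule sum.swap)
  also have "\<dots> = (\<Sum>i<d. \<Sum>j<d. \<Sum>k\<in>I. M k $$ (i, j) * v j * conjugate (v i))"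
    by (intro sum.cong refl sum.swap)
  finally show ?case by (simp add: sum_distrib_right)
qed simp

lemma psd_add_diag:
  fixes M :: "complex mat" and g :: "nat \<Rightarrow> real"
  assumes "psd d M" "\<And>i. 0 \<le> g i"
  shows "psd d (Matrix.mat d d (\<lambda>(i, j). M $$ (i, j) + (if i = j then complex_of_real (g i) else 0)))"
  unfolding psd_iff_sum
proof (intro conjI allI impI, goal_cases)
  case (2 i j)
  then show ?case using psd_conjugate_entry[OF assms(1) 2] by simp
next
  case (3 v)
  have "0 \<le> complex_of_real (g i) * (v i * cnj (v i))" for i
    using assms(2)[of i] conjugate_square_positive[of "v i"] by (auto simp: less_eq_complex_def)
  then have "0 \<le> (\<Sum>i<d. complex_of_real (g i) * (v i * cnj (v i)))" by (rule sum_nonneg)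
  moreover have "0 \<le> (\<Sum>i<d. \<Sum>j<d. M $$ (i, j) * v j * conjugate (v i))"
    by (rule psd_form_nonneg[OF assms(1)])
  ultimately have "0 \<le> (\<Sum>i<d. \<Sum>j<d. M $$ (i, j) * v j * conjugate (v i))
      + (\<Sum>i<d. complex_of_real (g i) * (v i * cnj (v i)))" by (rule add_nonneg_nonneg[rotated])
  also have "(\<Sum>i<d. complex_of_real (g i) * (v i * cnj (v i)))
      = (\<Sum>i<d. \<Sum>j<d. (if i = j then complex_of_real (g i) else 0) * v j * conjugate (v i))"
  proof (intro sum.cong refl)
    fix i assume "i \<in> {..<d}"
    have "(\<Sum>j<d. (if i = j then complex_of_real (g i) else 0) * v j * conjugate (v i))
        = (\<Sum>j<d. if i = j then complex_of_real (g i) * (v i * cnj (v i)) else 0)"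
      by (intro sum.cong refl) simp
    then show "complex_of_real (g i) * (v i * cnj (v i)) =
        (\<Sum>j<d. (if i = j then complex_of_real (g i) else 0) * v j * conjugate (v i))"
      using \<open>i \<in> {..<d}\<close> by simp
  qed
  finally show ?case by (simp add: distrib_right sum.distrib)
qed simp

text \<open>If the entry were nonzero, a suitable vector supported on \<open>i\<close> and
  \<open>j\<close> would make the quadratic form negative.\<close>

lemma psd_zero_diag:
  fixes M :: "complex mat"
  assumes M: "psd d M" and ij: "i < d" "j < d" and 0: "M $$ (i, i) = 0"
  shows "M $$ (i, j) = 0"
proof (rule ccontr)
  assume n0: "M $$ (i, j) \<noteq> 0"
  then have neq: "i \<noteq> j" using 0 by auto
  have ji: "M $$ (j, i) = cnj (M $$ (i, j))" using psd_conjugate_entry[OF M ij(2,1)] by simp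
  define m where "m = (cmod (M $$ (i, j)))\<^sup>2"
  have m: "m > 0" using n0 by (simp add: m_def)
  \<comment> \<open>At the vector \<open>v\<close> below, the form equals
    \<open>M $$ (j, j) - 2 * t * m\<close>; this \<open>t\<close> makes it -1.\<close>
  define t where "t = (Re (M $$ (j, j)) + 1) / (2 * m)"
  define v where "v k = (if k = i then - complex_of_real t * M $$ (i, j) else if k = j then 1 else 0)" for k
  have "(\<Sum>k<d. \<Sum>l<d. M $$ (k, l) * v l * conjugate (v k))
      = (\<Sum>k\<in>{i, j}. \<Sum>l\<in>{i, j}. M $$ (k, l) * v l * conjugate (v k))"
    by (intro sum.mono_neutral_cong_right) (use ij in \<open>auto simp: v_def intro!: sum.mono_neutral_right\<close>)
  also have "\<dots> = M $$ (j, j) - 2 * complex_of_real t * (M $$ (i, j) * cnj (M $$ (i, j)))"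
    using neq 0 by (simp add: v_def ji algebra_simps)
  also have "\<dots> = M $$ (j, j) - 2 * complex_of_real t * complex_of_real m"
    by (simp only: m_def complex_norm_square[symmetric] of_real_power)
  finally have "0 \<le> M $$ (j, j) - 2 * complex_of_real t * complex_of_real m"
    using psd_form_nonneg[OF M, of v] by simp
  then have "0 \<le> Re (M $$ (j, j)) - 2 * t * m" by (simp add: less_eq_complex_def)
  also have "\<dots> = -1" using m by (simp add: t_def field_simps)
  finally show False by simp
qed

text \<open>For a complex vector with real part \<open>x\<close> and imaginary part
  \<open>y\<close>, symmetry cancels the mixed terms, and what remains is the real form at
  \<open>x\<close> plus the real form at \<open>y\<close>.\<close>

lemma psd_map_complex_of_real:
  fixes M :: "real mat"
  assumes "psd d M"
  shows "psd d (map_mat complex_of_real M)"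
  unfolding psd_iff_sum
proof (intro conjI allI impI, goal_cases)
  case 1
  show ?case using assms by simp
next
  case (2 i j)
  then show ?case using psd_conjugate_entry[OF assms 2] psd_carrier[OF assms] by simp
next
  case (3 v)
  define x where "x i = Re (v i)" for i
  define y where "y i = Im (v i)" for i
  have v: "v i = Complex (x i) (y i)" for i by (simp add: x_def y_def)
  let ?S = "\<Sum>i<d. \<Sum>j<d. map_mat complex_of_real M $$ (i, j) * v j * conjugate (v i)"
  have S: "?S = (\<Sum>i<d. \<Sum>j<d. complex_of_real (M $$ (i, j)) * v j * cnj (v i))"
    using psd_carrier[OF assms] by (intro sum.cong refl) simp
  have "Re ?S = (\<Sum>i<d. \<Sum>j<d. M $$ (i, j) * x j * x i) + (\<Sum>i<d. \<Sum>j<d. M $$ (i, j) * y j * y i)"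
    unfolding S Re_sum sum.distrib[symmetric]
    by (intro sum.cong refl) (simp add: v algebra_simps)
  moreover have "0 \<le> (\<Sum>i<d. \<Sum>j<d. M $$ (i, j) * x j * conjugate (x i))"
    "0 \<le> (\<Sum>i<d. \<Sum>j<d. M $$ (i, j) * y j * conjugate (y i))"
    by (rule psd_form_nonneg[OF assms])+
  moreover have "Im ?S = 0"
  proof -
    have "Im ?S = (\<Sum>i<d. \<Sum>j<d. M $$ (i, j) * y j * x i) - (\<Sum>i<d. \<Sum>j<d. M $$ (i, j) * x j * y i)"
      unfolding S Im_sum sum_subtractf[symmetric]
      by (intro sum.cong refl) (simp add: v algebra_simps)
    also have "(\<Sum>i<d. \<Sum>j<d. M $$ (i, j) * x j * y i) = (\<Sum>j<d. \<Sum>i<d. M $$ (i, j) * x j * y i)"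
      by (rule sum.swap)
    also have "\<dots> = (\<Sum>i<d. \<Sum>j<d. M $$ (i, j) * y j * x i)"
      using psd_conjugate_entry[OF assms] by (intro sum.cong refl) (simp add: mult_ac)
    finally show ?thesis by simp
  qed
  ultimately show "0 \<le> ?S" by (simp add: less_eq_complex_def)
qed

section \<open>Realification of complex matrices\<close>

(* The factor 1 / sqrt 2 makes the map an isometry for the real part of the trace inner product. *)
definition realification :: "complex mat \<Rightarrow> real mat" where
  "realification M = (1 / sqrt 2) \<cdot>\<^sub>m
     four_block_mat (map_mat Re M) (map_mat (\<lambda>z. - Im z) M) (map_mat Im M) (map_mat Re M)"

lemma sum_lessThan_add:
  fixes f :: "nat \<Rightarrow> 'a::comm_monoid_add"
  shows "(\<Sum>i<m + n. f i) = (\<Sum>i<m. f i) + (\<Sum>i<n. f (m + i))"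
  by (induction n) (simp_all add: add.assoc)

lemma realification_carrier [simp]:
  "M \<in> carrier_mat d d \<Longrightarrow> realification M \<in> carrier_mat (d + d) (d + d)"
  by (simp add: realification_def)

lemma index_realification:
  assumes "M \<in> carrier_mat d d" "i < d" "j < d"
  shows "realification M $$ (i, j) = Re (M $$ (i, j)) / sqrt 2"
    "realification M $$ (i, d + j) = - Im (M $$ (i, j)) / sqrt 2"
    "realification M $$ (d + i, j) = Im (M $$ (i, j)) / sqrt 2"
    "realification M $$ (d + i, d + j) = Re (M $$ (i, j)) / sqrt 2"
  using assms by (auto simp: realification_def)

text \<open>Read the two halves of a real vector as real and imaginary parts of a complex vector
  \<open>z\<close>. The real form is then the real part of the form of \<open>M\<close> at
  \<open>z\<close>, up to the positive factor \<open>1 / sqrt 2\<close>.\<close>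

lemma psd_realification:
  assumes "psd d M"
  shows "psd (d + d) (realification M)"
  unfolding psd_iff_sum
proof (intro conjI allI impI)
  note M = psd_carrier[OF assms]
  show "realification M \<in> carrier_mat (d + d) (d + d)" using M by simp
  have herm: "Re (M $$ (j, i)) = Re (M $$ (i, j))" "Im (M $$ (j, i)) = - Im (M $$ (i, j))"
    if "i < d" "j < d" for i j
    using psd_conjugate_entry[OF assms that] by (auto simp: complex_eq_iff)
  show "conjugate (realification M $$ (j, i)) = realification M $$ (i, j)"
    if ij: "i < d + d" "j < d + d" for i j
  proof -
    have split: "k < d \<or> (\<exists>k'<d. k = d + k')" if "k < d + d" for k
      using that by (metis add.commute less_diff_conv2 le_add_diff_inverse linorder_not_le)
    have "realification M $$ (l, k) = realification M $$ (k, l)"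
      "realification M $$ (d + l, k) = realification M $$ (k, d + l)"
      "realification M $$ (d + l, d + k) = realification M $$ (d + k, d + l)" if "k < d" "l < d" for k l
      using that herm[OF that] by (simp_all add: index_realification[OF M])
    then show ?thesis
      using split[OF ij(1)] split[OF ij(2)] unfolding conjugate_real_def by metis
  qed
  fix v
  define z where "z i = Complex (v i) (v (d + i))" for i
  have "0 \<le> (\<Sum>i<d. \<Sum>j<d. M $$ (i, j) * z j * conjugate (z i))"
    by (rule psd_form_nonneg[OF assms])
  then have "0 \<le> Re (\<Sum>i<d. \<Sum>j<d. M $$ (i, j) * z j * conjugate (z i)) / sqrt 2"
    by (simp add: less_eq_complex_def)
  also have "\<dots> = (\<Sum>i<d + d. \<Sum>j<d + d. realification M $$ (i, j) * v j * conjugate (v i))"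
    unfolding sum_lessThan_add sum.distrib[symmetric] Re_sum sum_divide_distrib
    by (intro sum.cong refl) (simp add: index_realification[OF M] z_def, simp add: algebra_simps add_divide_distrib diff_divide_distrib)
  finally show "0 \<le> (\<Sum>i<d + d. \<Sum>j<d + d. realification M $$ (i, j) * v j * conjugate (v i))" .
qed

section \<open>Traces of products\<close>

lemma mat_trace_mult:
  assumes "A \<in> carrier_mat n m" "B \<in> carrier_mat m n"
  shows "mat_trace (A * B) = (\<Sum>i<n. \<Sum>j<m. A $$ (i, j) * B $$ (j, i))"
  using assms by (auto simp: mat_trace_def index_mult_mat_sum simp del: index_mult_mat(1) intro!: sum.cong)

lemma mat_trace_comm:
  fixes A B :: "'a::comm_semiring_0 mat"
  assumes "A \<in> carrier_mat n m" "B \<in> carrier_mat m n"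
  shows "mat_trace (A * B) = mat_trace (B * A)"
  unfolding mat_trace_mult[OF assms] mat_trace_mult[OF assms(2,1)]
  by (subst sum.swap) (simp add: mult.commute)

text \<open>The four block products contribute the real part of each product of entries twice, and
  the two scaling factors contribute 1/2.\<close>

lemma mat_trace_realification:
  assumes "M \<in> carrier_mat d d" "N \<in> carrier_mat d d"
  shows "mat_trace (realification M * realification N) = Re (mat_trace (M * N))"
  unfolding mat_trace_mult[OF realification_carrier[OF assms(1)] realification_carrier[OF assms(2)]]
    mat_trace_mult[OF assms] sum_lessThan_add sum.distrib[symmetric] Re_sum
  by (intro sum.cong refl) (simp add: index_realification[OF assms(1)] index_realification[OF assms(2)])

lemma mat_trace_map_complex_of_real:
  assumes "M \<in> carrier_mat d d" "N \<in> carrier_mat d d"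
  shows "mat_trace (map_mat complex_of_real M * map_mat complex_of_real N)
    = complex_of_real (mat_trace (M * N))"
proof -
  have "map_mat complex_of_real M \<in> carrier_mat d d" "map_mat complex_of_real N \<in> carrier_mat d d"
    using assms by auto
  then show ?thesis using assms by (simp add: mat_trace_mult[of _ d d])
qed

text \<open>The inner \<open>V * mat_adjoint V\<close> cancels directly, the outer one after cycling
  the trace.\<close>

lemma mat_trace_unitary_congruence:
  fixes A B V :: "complex mat"
  assumes A: "A \<in> carrier_mat d d" and B: "B \<in> carrier_mat d d" and V: "V \<in> carrier_mat d d"
    and VV: "V * mat_adjoint V = 1\<^sub>m d"
  shows "mat_trace ((mat_adjoint V * A * V) * (mat_adjoint V * B * V)) = mat_trace (A * B)"
proof -
  have Va: "mat_adjoint V \<in> carrier_mat d d" using V by simp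
  have AV: "A * V \<in> carrier_mat d d" and VB: "mat_adjoint V * B \<in> carrier_mat d d"
    and VBV: "mat_adjoint V * B * V \<in> carrier_mat d d" and AB: "A * B \<in> carrier_mat d d"
    and BV: "B * V \<in> carrier_mat d d"
    using A B V Va by (auto intro!: carrier_matI)
  have VVB: "V * (mat_adjoint V * B) = B"
    unfolding assoc_mult_mat[OF V Va B, symmetric] VV by (rule left_mult_one_mat[OF B])
  have "(mat_adjoint V * A * V) * (mat_adjoint V * B * V) = mat_adjoint V * (A * (V * (mat_adjoint V * B)) * V)"
    unfolding assoc_mult_mat[OF Va A V] assoc_mult_mat[OF Va AV VBV] assoc_mult_mat[OF A V VBV]
      assoc_mult_mat[OF A mult_carrier_mat[OF V VB] V] assoc_mult_mat[OF V VB V] ..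
  also have "\<dots> = mat_adjoint V * (A * B * V)" by (simp add: VVB)
  also have "mat_trace \<dots> = mat_trace (A * B * V * mat_adjoint V)"
    by (rule mat_trace_comm[OF Va mult_carrier_mat[OF AB V]])
  also have "A * B * V * mat_adjoint V = A * B"
    unfolding assoc_mult_mat[OF AB V Va] VV by (rule right_mult_one_mat[OF AB])
  finally show ?thesis .
qed

text \<open>In an eigenbasis of \<open>M\<close> the trace pairs the eigenvalues of \<open>M\<close>
  with the diagonal entries of the transformed \<open>N\<close>, and both are nonnegative.\<close>

lemma mat_trace_psd_mult_nonneg:
  fixes M N :: "complex mat"
  assumes M: "psd d M" and N: "psd d N"
  shows "0 \<le> mat_trace (M * N)"
proof -
  obtain V D where V: "V \<in> carrier_mat d d" "mat_adjoint V * V = 1\<^sub>m d" "V * mat_adjoint V = 1\<^sub>m d"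
    and D: "\<And>i. 0 \<le> D i"
    and MD: "mat_adjoint V * M * V = Matrix.mat d d (\<lambda>(i, j). if i = j then complex_of_real (D i) else 0)"
    using psd_diagonalization[OF M] by blast
  define P where "P = mat_adjoint V * N * V"
  have P: "psd d P" unfolding P_def by (rule psd_congruence[OF N V(1)])
  have "mat_trace (M * N) = mat_trace ((mat_adjoint V * M * V) * P)"
    unfolding P_def by (rule mat_trace_unitary_congruence[symmetric]) (use M N V in auto)
  also have "\<dots> = (\<Sum>i<d. \<Sum>j<d. (if i = j then complex_of_real (D i) else 0) * P $$ (j, i))"
    unfolding MD by (subst mat_trace_mult[of _ d d]) (use P in auto)
  also have "\<dots> = (\<Sum>i<d. \<Sum>j<d. if i = j then complex_of_real (D i) * P $$ (i, i) else 0)"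
    by (intro sum.cong refl) simp
  also have "\<dots> = (\<Sum>i<d. complex_of_real (D i) * P $$ (i, i))" by simp
  also have "\<dots> \<ge> 0"
    by (intro sum_nonneg mult_nonneg_nonneg psd_diag_nonneg[OF P]) (use D in \<open>auto simp: less_eq_complex_def\<close>)
  finally show ?thesis .
qed

text \<open>Bilinearity of the trace form: a block sum of a Gram matrix is the trace pairing of the
  two summed families.\<close>

lemma sum_mat_trace_mult:
  fixes Z :: "'k \<Rightarrow> 'a::comm_semiring_0 mat"
  assumes Z: "\<And>k. Z k \<in> carrier_mat d d"
  shows "(\<Sum>k\<in>I. \<Sum>l\<in>J. mat_trace (Z k * Z l)) =
    (\<Sum>i<d. \<Sum>j<d. (\<Sum>k\<in>I. Z k $$ (i, j)) * (\<Sum>l\<in>J. Z l $$ (j, i)))"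
proof -
  have "(\<Sum>k\<in>I. \<Sum>l\<in>J. mat_trace (Z k * Z l)) =
      (\<Sum>k\<in>I. \<Sum>l\<in>J. \<Sum>i<d. \<Sum>j<d. Z k $$ (i, j) * Z l $$ (j, i))"
    by (simp add: mat_trace_mult[OF Z Z])
  also have "\<dots> = (\<Sum>k\<in>I. \<Sum>i<d. \<Sum>l\<in>J. \<Sum>j<d. Z k $$ (i, j) * Z l $$ (j, i))"
    by (intro sum.cong refl sum.swap)
  also have "\<dots> = (\<Sum>i<d. \<Sum>k\<in>I. \<Sum>l\<in>J. \<Sum>j<d. Z k $$ (i, j) * Z l $$ (j, i))"
    by (rule sum.swap)
  also have "\<dots> = (\<Sum>i<d. \<Sum>k\<in>I. \<Sum>j<d. \<Sum>l\<in>J. Z k $$ (i, j) * Z l $$ (j, i))"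
    by (intro sum.cong refl sum.swap)
  also have "\<dots> = (\<Sum>i<d. \<Sum>j<d. \<Sum>k\<in>I. \<Sum>l\<in>J. Z k $$ (i, j) * Z l $$ (j, i))"
    by (intro sum.cong refl sum.swap)
  finally show ?thesis by (simp add: sum_product)
qed

section \<open>Kronecker products as traces\<close>

lemma sum_lessThan_times:
  fixes f :: "nat \<Rightarrow> 'a::comm_monoid_add"
  shows "(\<Sum>q<m * n. f q) = (\<Sum>i<m. \<Sum>j<n. f (i * n + j))"
proof (induction m)
  case (Suc m)
  have "(\<Sum>q<Suc m * n. f q) = (\<Sum>q<m * n + n. f q)" by (simp add: add.commute)
  then show ?case by (simp add: sum_lessThan_add Suc)
qed simp

lemma pair_index_less:
  fixes i j m n :: nat
  assumes "i < m" "j < n"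
  shows "i * n + j < m * n"
proof -
  have "i * n + j < Suc i * n" using assms by simp
  also have "\<dots> \<le> m * n" using assms by (intro mult_le_mono1) simp
  finally show ?thesis .
qed

text \<open>With the row-major numbering of the product basis, \<psi> becomes a matrix \<Psi>, and
  applying \<open>kronecker X Y\<close> to \<psi> amounts to replacing \<Psi> by
  \<open>X * \<Psi> * transpose_mat Y\<close>.\<close>

lemma kronecker_form:
  fixes X Y :: "complex mat"
  assumes X: "X \<in> carrier_mat m m" and Y: "Y \<in> carrier_mat n n" and psi: "\<psi> \<in> carrier_vec (m * n)"
  defines "\<Psi> \<equiv> Matrix.mat m n (\<lambda>(i, j). \<psi> $ (i * n + j))"
  shows "(kronecker X Y *\<^sub>v \<psi>) \<bullet>c \<psi> = mat_trace (X * (\<Psi> * transpose_mat Y * mat_adjoint \<Psi>))"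
proof -
  have K: "kronecker X Y \<in> carrier_mat (m * n) (m * n)" using X Y by (simp add: kronecker_def)
  have Psi: "\<Psi> \<in> carrier_mat m n" "transpose_mat Y \<in> carrier_mat n n" "mat_adjoint \<Psi> \<in> carrier_mat n m"
    using Y by (auto simp: \<Psi>_def)
  note PY = mult_carrier_mat[OF Psi(1,2)]
  have "(kronecker X Y *\<^sub>v \<psi>) \<bullet>c \<psi> =
      (\<Sum>i<m. \<Sum>j<n. \<Sum>k<m. \<Sum>l<n. X $$ (i, k) * Y $$ (j, l) * \<psi> $ (k * n + l) * cnj (\<psi> $ (i * n + j)))"
    unfolding form_eq_sum[OF K psi psi] sum_lessThan_times
    using X Y pair_index_less by (intro sum.cong refl) (simp add: kronecker_def)
  also have "\<dots> = (\<Sum>i<m. \<Sum>k<m. \<Sum>j<n. \<Sum>l<n. X $$ (i, k) * Y $$ (j, l) * \<psi> $ (k * n + l) * cnj (\<psi> $ (i * n + j)))"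
    by (intro sum.cong refl sum.swap)
  also have "\<dots> = (\<Sum>i<m. \<Sum>k<m. X $$ (i, k) * (\<Psi> * transpose_mat Y * mat_adjoint \<Psi>) $$ (k, i))"
  proof (intro sum.cong refl)
    fix i k assume "i \<in> {..<m}" "k \<in> {..<m}"
    then have i: "i < m" and k: "k < m" by auto
    have "(\<Psi> * transpose_mat Y * mat_adjoint \<Psi>) $$ (k, i) =
        (\<Sum>j<n. (\<Sum>l<n. \<Psi> $$ (k, l) * transpose_mat Y $$ (l, j)) * mat_adjoint \<Psi> $$ (j, i))"
      unfolding index_mult_mat_sum[OF PY Psi(3) k i]
      by (intro sum.cong refl) (simp add: index_mult_mat_sum[OF Psi(1,2) k] del: index_mult_mat(1))
    also have "\<dots> = (\<Sum>j<n. \<Sum>l<n. Y $$ (j, l) * \<psi> $ (k * n + l) * cnj (\<psi> $ (i * n + j)))"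
      using Y i k by (intro sum.cong refl) (simp add: \<Psi>_def sum_distrib_right sum_distrib_left mult_ac)
    finally show "(\<Sum>j<n. \<Sum>l<n. X $$ (i, k) * Y $$ (j, l) * \<psi> $ (k * n + l) * cnj (\<psi> $ (i * n + j))) =
        X $$ (i, k) * (\<Psi> * transpose_mat Y * mat_adjoint \<Psi>) $$ (k, i)"
      by (simp add: sum_distrib_left mult_ac)
  qed
  also have "\<dots> = mat_trace (X * (\<Psi> * transpose_mat Y * mat_adjoint \<Psi>))"
    by (rule mat_trace_mult[OF X mult_carrier_mat[OF PY Psi(3)], symmetric])
  finally show ?thesis .
qed

section \<open>Block sums\<close>

lemma sum_block:
  "(\<Sum>k\<in>block (Inl s). f k) = (\<Sum>a\<in>UNIV. f (Inl (s, a)))"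
  "(\<Sum>k\<in>block (Inr t). f k) = (\<Sum>b\<in>UNIV. f (Inr (t, b)))"
  by (simp_all add: sum.reindex inj_on_def)

lemma block_sum_Inl_Inr:
  "block_sum (Inl s) (Inr t) X = (\<Sum>a\<in>UNIV. \<Sum>b\<in>UNIV. X $h Inl (s, a) $h Inr (t, b))"
  unfolding block_sum_def sum_block ..

text \<open>Normalisation of \<open>p\<close> at \<open>s\<close>, \<open>t\<close> is the block sum
  condition for that pair. By monotonicity of \<open>Corr\<close> the result serves all four cones,
  since each lies in the nonnegative one.\<close>

lemma correlations_if_Corr_nonneg:
  fixes p :: "('a::finite, 'b::finite, 's::finite, 't::finite) corr"
  assumes "p \<in> Corr nonneg_cone"
  shows "p \<in> correlations"
proof -
  obtain X :: "('a, 'b, 's, 't) bell_matrix" where X: "X \<in> nonneg_cone"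
    and B: "\<And>i j. block_sum i j X = 1"
    and p: "\<And>a b s t. X $h Inl (s, a) $h Inr (t, b) = p a b s t"
    using assms by (auto simp: Corr_def)
  have "0 \<le> p a b s t" for a b s t using X by (auto simp: nonneg_cone_def simp flip: p)
  moreover have "(\<Sum>a\<in>UNIV. \<Sum>b\<in>UNIV. p a b s t) = 1" for s t
    using B[of "Inl s" "Inr t"] by (simp add: block_sum_Inl_Inr p)
  ultimately show ?thesis by (simp add: correlations_def)
qed

lemma CorrI:
  assumes "X \<in> K" "\<And>i j. block_sum i j X = 1" "\<And>a b s t. X $h Inl (s, a) $h Inr (t, b) = p a b s t"
  shows "p \<in> Corr K"
  unfolding Corr_def using assms by (intro CollectI bexI[of _ X]) auto

lemma Corr_mono: "K \<subseteq> L \<Longrightarrow> Corr K \<subseteq> Corr L"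
  by (auto simp: Corr_def)

text \<open>The squared distance of \<open>f\<close> and \<open>g\<close> is
  \<open>c - 2 * c + c\<close>. This is what forces the block sums of Gram vectors to
  coincide.\<close>

lemma eq_if_sum_products_eq:
  fixes f g :: "'i \<Rightarrow> real"
  assumes "finite I" "(\<Sum>i\<in>I. f i * f i) = c" "(\<Sum>i\<in>I. f i * g i) = c" "(\<Sum>i\<in>I. g i * g i) = c" "i \<in> I"
  shows "f i = g i"
proof -
  have "(\<Sum>i\<in>I. (f i - g i)\<^sup>2) = (\<Sum>i\<in>I. f i * f i) - 2 * (\<Sum>i\<in>I. f i * g i) + (\<Sum>i\<in>I. g i * g i)"
    by (simp add: power2_eq_square algebra_simps sum.distrib sum_subtractf sum_distrib_left)
  also have "\<dots> = 0" using assms by simp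
  finally show ?thesis using assms(1,5) by (simp add: sum_nonneg_eq_0_iff)
qed

section \<open>All correlations and no-signaling correlations\<close>

(* The diagonal blocks are constant; the cones in question do not constrain them any further. *)
definition corr_matrix ::
  "('a::finite, 'b::finite, 's::finite, 't::finite) corr \<Rightarrow> ('a, 'b, 's, 't) bell_matrix" where
  "corr_matrix p = (\<chi> k l. case k of
      Inl (s, a) \<Rightarrow> (case l of Inl _ \<Rightarrow> 1 / (real CARD('a))\<^sup>2 | Inr (t, b) \<Rightarrow> p a b s t)
    | Inr (t, b) \<Rightarrow> (case l of Inl (s, a) \<Rightarrow> p a b s t | Inr _ \<Rightarrow> 1 / (real CARD('b))\<^sup>2))"

lemma corr_matrix_nth [simp]:
  fixes p :: "('a::finite, 'b::finite, 's::finite, 't::finite) corr"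
  shows "corr_matrix p $h Inl (s, a) $h Inl (s', a') = 1 / (real CARD('a))\<^sup>2"
    "corr_matrix p $h Inl (s, a) $h Inr (t, b) = p a b s t"
    "corr_matrix p $h Inr (t, b) $h Inl (s, a) = p a b s t"
    "corr_matrix p $h Inr (t, b) $h Inr (t', b') = 1 / (real CARD('b))\<^sup>2"
  by (simp_all add: corr_matrix_def)

lemma corr_matrix_nonneg_cone:
  assumes "p \<in> correlations"
  shows "corr_matrix p \<in> nonneg_cone"
proof -
  have "corr_matrix p $h k $h l = corr_matrix p $h l $h k" for k l
    by (cases k; cases l) (auto split: prod.splits)
  moreover have "0 \<le> corr_matrix p $h k $h l" for k l
    using assms by (cases k; cases l) (auto simp: correlations_def)
  ultimately show ?thesis
    by (simp add: nonneg_cone_def sym_matrices_def Finite_Cartesian_Product.transpose_def vec_eq_iff)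
qed

text \<open>The constants of the diagonal blocks are the inverses of their numbers of entries; the
  other blocks sum to 1 because \<open>p\<close> is normalised.\<close>

lemma block_sum_corr_matrix:
  fixes p :: "('a::finite, 'b::finite, 's::finite, 't::finite) corr"
  assumes "p \<in> correlations"
  shows "block_sum i j (corr_matrix p) = 1"
proof -
  have swap: "(\<Sum>b\<in>UNIV. \<Sum>a\<in>UNIV. p a b s t) = (\<Sum>a\<in>UNIV. \<Sum>b\<in>UNIV. p a b s t)" for s t
    by (rule sum.swap)
  show ?thesis
    using assms by (cases i; cases j; simp only: block_sum_def sum_block corr_matrix_nth)
      (simp_all add: swap power2_eq_square correlations_def)
qed

lemma correlations_iff_Corr:
  "p \<in> correlations \<longleftrightarrow> p \<in> Corr nonneg_cone"
proof
  assume "p \<in> correlations"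
  then show "p \<in> Corr nonneg_cone"
    by (intro CorrI[of "corr_matrix p"]) (simp_all add: corr_matrix_nonneg_cone block_sum_corr_matrix)
qed (rule correlations_if_Corr_nonneg)

text \<open>The linear equations of the cone concern only the block that carries \<open>p\<close>,
  and there they are the no-signaling equations.\<close>

lemma no_signaling_iff_Corr:
  "p \<in> no_signaling \<longleftrightarrow> p \<in> Corr nso_cone"
proof
  assume p: "p \<in> no_signaling"
  then have "p \<in> correlations" by (simp add: no_signaling_def)
  then have "corr_matrix p \<in> nso_cone" "\<And>i j. block_sum i j (corr_matrix p) = 1"
    using p corr_matrix_nonneg_cone[of p] block_sum_corr_matrix[of p]
    by (auto simp: nso_cone_def no_signaling_def)
  then show "p \<in> Corr nso_cone"
    by (intro CorrI[of "corr_matrix p"]) simp_all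
next
  assume p: "p \<in> Corr nso_cone"
  have "nso_cone \<subseteq> nonneg_cone" by (auto simp: nso_cone_def)
  from Corr_mono[OF this] p have "p \<in> correlations"
    using correlations_if_Corr_nonneg by blast
  then show "p \<in> no_signaling"
    using p by (auto simp: no_signaling_def Corr_def nso_cone_def)
qed

section \<open>Classical correlations\<close>

lemma sum_scalar_prod:
  fixes x :: "'k \<Rightarrow> real vec"
  assumes "\<And>k. x k \<in> carrier_vec d"
  shows "(\<Sum>k\<in>I. \<Sum>l\<in>J. x k \<bullet> x l) = (\<Sum>c<d. (\<Sum>k\<in>I. x k $ c) * (\<Sum>l\<in>J. x l $ c))"
proof -
  have "(\<Sum>k\<in>I. \<Sum>l\<in>J. x k \<bullet> x l) = (\<Sum>k\<in>I. \<Sum>l\<in>J. \<Sum>c<d. x k $ c * x l $ c)"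
    by (simp add: scalar_prod_def atLeast0LessThan carrier_vecD[OF assms])
  also have "\<dots> = (\<Sum>k\<in>I. \<Sum>c<d. \<Sum>l\<in>J. x k $ c * x l $ c)"
    by (intro sum.cong refl sum.swap)
  also have "\<dots> = (\<Sum>c<d. \<Sum>k\<in>I. \<Sum>l\<in>J. x k $ c * x l $ c)"
    by (rule sum.swap)
  finally show ?thesis by (simp add: sum_product)
qed

lemma cp_cone_subset_nonneg: "cp_cone \<subseteq> nonneg_cone"
proof
  fix X :: "real ^ 'n ^ 'n" assume "X \<in> cp_cone"
  then obtain d and x :: "'n \<Rightarrow> real vec"
    where "\<forall>i. x i \<in> carrier_vec d \<and> (\<forall>k<d. 0 \<le> x i $ k)" and X: "X = (\<chi> i j. x i \<bullet> x j)"
    unfolding cp_cone_def mem_Collect_eq by (elim exE conjE)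
  then have x: "\<And>i. x i \<in> carrier_vec d" "\<And>i k. k < d \<Longrightarrow> 0 \<le> x i $ k" by auto
  have dot: "x i \<bullet> x j = (\<Sum>c<d. x i $ c * x j $ c)" for i j
    by (simp add: scalar_prod_def atLeast0LessThan carrier_vecD[OF x(1)])
  show "X \<in> nonneg_cone"
    using x(2) by (auto simp: nonneg_cone_def sym_matrices_def Finite_Cartesian_Product.transpose_def
        X dot vec_eq_iff mult.commute intro!: sum_nonneg mult_nonneg_nonneg)
qed

lemma Corr_cp_if_classical:
  fixes p :: "('a::finite, 'b::finite, 's::finite, 't::finite) corr"
  assumes "p \<in> classical"
  shows "p \<in> Corr cp_cone"
proof -
  from assms obtain n :: nat and k :: "nat \<Rightarrow> real" and x :: "'a \<Rightarrow> 's \<Rightarrow> nat \<Rightarrow> real"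
    and y :: "'b \<Rightarrow> 't \<Rightarrow> nat \<Rightarrow> real" where n: "n \<ge> 1"
    and k: "\<forall>i<n. 0 \<le> k i" and x: "\<forall>i<n. \<forall>a s. 0 \<le> x a s i"
    and y: "\<forall>i<n. \<forall>b t. 0 \<le> y b t i" and k1: "(\<Sum>i<n. k i) = 1"
    and x1: "\<forall>i<n. \<forall>s. (\<Sum>a\<in>UNIV. x a s i) = 1"
    and y1: "\<forall>i<n. \<forall>t. (\<Sum>b\<in>UNIV. y b t i) = 1"
    and p: "\<forall>a b s t. p a b s t = (\<Sum>i<n. k i * x a s i * y b t i)"
    unfolding classical_def mem_Collect_eq by (elim conjE exE)
  \<comment> \<open>Each Gram vector carries the square root of the weight, so a product of two
    coordinates carries the full weight \<open>k i\<close>.\<close>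
  define z :: "'s \<times> 'a + 't \<times> 'b \<Rightarrow> real vec" where
    "z l = Matrix.vec n (\<lambda>i. sqrt (k i) * (case l of Inl (s, a) \<Rightarrow> x a s i | Inr (t, b) \<Rightarrow> y b t i))" for l
  have z: "z l \<in> carrier_vec n" for l by (simp add: z_def)
  define X where "X = (\<chi> i j. z i \<bullet> z j)"
  have "0 \<le> z l $ i" if "i < n" for l i
    using that k x y by (auto simp: z_def split: sum.splits)
  then have "X \<in> cp_cone" using n z unfolding cp_cone_def X_def
    by (intro CollectI exI[of _ n] exI[of _ z] conjI) auto
  moreover have "block_sum i j X = 1" for i j
  proof -
    \<comment> \<open>All blocks have the same vector sum, with coordinates
      \<open>sqrt (k c)\<close>; its squared norm is the total weight 1.\<close>
    have S: "(\<Sum>l\<in>block i. z l $ c) = sqrt (k c)" if "c < n" for i c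
      using that by (cases i; simp only: sum_block) (simp_all add: z_def x1 y1 flip: sum_distrib_left)
    show ?thesis
      unfolding block_sum_def X_def using k k1 by (simp add: sum_scalar_prod[OF z] S)
  qed
  moreover have "X $h Inl (s, a) $h Inr (t, b) = p a b s t" for a b s t
    by (auto simp: p X_def z_def scalar_prod_def atLeast0LessThan k intro!: sum.cong)
  ultimately show ?thesis by (rule CorrI)
qed

lemma classical_if_Corr_cp:
  fixes p :: "('a::finite, 'b::finite, 's::finite, 't::finite) corr"
  assumes "p \<in> Corr cp_cone"
  shows "p \<in> classical"
proof -
  have corr: "p \<in> correlations"
    using assms Corr_mono[OF cp_cone_subset_nonneg] correlations_if_Corr_nonneg by blast
  from assms obtain X :: "('a, 'b, 's, 't) bell_matrix" where X: "X \<in> cp_cone"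
    and B: "\<And>i j. block_sum i j X = 1" and p': "\<And>a b s t. X $h Inl (s, a) $h Inr (t, b) = p a b s t"
    unfolding Corr_def by blast
  from X obtain d and z :: "'s \<times> 'a + 't \<times> 'b \<Rightarrow> real vec" where d: "d \<ge> 1"
    and "\<forall>k. z k \<in> carrier_vec d \<and> (\<forall>c<d. 0 \<le> z k $ c)" and X: "X = (\<chi> k l. z k \<bullet> z l)"
    unfolding cp_cone_def mem_Collect_eq by (elim exE conjE)
  then have z: "\<And>k. z k \<in> carrier_vec d" and nn: "\<And>k c. c < d \<Longrightarrow> 0 \<le> z k $ c" by auto
  have p: "z (Inl (s, a)) \<bullet> z (Inr (t, b)) = p a b s t" for a b s t
    using p'[of s a t b] by (simp add: X)
  have U: "(\<Sum>c<d. (\<Sum>k\<in>block i. z k $ c) * (\<Sum>l\<in>block j. z l $ c)) = 1" for i j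
    using B[of i j] by (simp add: block_sum_def X sum_scalar_prod[OF z])
  \<comment> \<open>Any block may serve here, since all block sums are equal;
    \<open>undefined\<close> stands for an arbitrary setting.\<close>
  define u where "u c = (\<Sum>k\<in>block (Inl undefined). z k $ c)" for c
  have u: "(\<Sum>k\<in>block i. z k $ c) = u c" if "c < d" for i c
    unfolding u_def by (rule eq_if_sum_products_eq[OF finite_lessThan U U U]) (use that in simp)
  have ux: "(\<Sum>a\<in>UNIV. z (Inl (s, a)) $ c) = u c" and uy: "(\<Sum>b\<in>UNIV. z (Inr (t, b)) $ c) = u c"
    if "c < d" for c s t
    using u[OF that, of "Inl s"] u[OF that, of "Inr t"] by (simp_all only: sum_block)
  have zero: "z (Inl (s, a)) $ c = 0" if "c < d" "u c = 0" for c s a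
    using ux[OF that(1), of s] nn[OF that(1)] that(2) by (simp add: sum_nonneg_eq_0_iff)
  \<comment> \<open>Where \<open>u c = 0\<close> the weight \<open>u c * u c\<close> vanishes, so
    the uniform distribution is only a filler that keeps the sums equal to 1.\<close>
  define x where "x a s c = (if u c = 0 then 1 / real CARD('a) else z (Inl (s, a)) $ c / u c)" for a s c
  define y where "y b t c = (if u c = 0 then 1 / real CARD('b) else z (Inr (t, b)) $ c / u c)" for b t c
  have u0: "0 \<le> u c" if "c < d" for c
    unfolding u_def using nn[OF that] by (intro sum_nonneg)
  have "(\<Sum>c<d. u c * u c) = 1" using U by (simp add: u)
  moreover have "(\<Sum>a\<in>UNIV. x a s c) = 1" "(\<Sum>b\<in>UNIV. y b t c) = 1" if "c < d" for c s t
    using ux[OF that] uy[OF that]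
    by (cases "u c = 0"; simp add: x_def y_def flip: sum_divide_distrib)+
  moreover have "0 \<le> x a s c" "0 \<le> y b t c" if "c < d" for c a s b t
    using nn[OF that] u0[OF that] by (auto simp: x_def y_def)
  moreover have "p a b s t = (\<Sum>c<d. u c * u c * x a s c * y b t c)" for a b s t
  proof -
    have "p a b s t = (\<Sum>c<d. z (Inl (s, a)) $ c * z (Inr (t, b)) $ c)"
      by (simp add: scalar_prod_def atLeast0LessThan carrier_vecD[OF z] flip: p)
    also have "\<dots> = (\<Sum>c<d. u c * u c * x a s c * y b t c)"
      \<comment> \<open>Dividing by \<open>u c\<close> twice cancels the weight; if
        \<open>u c = 0\<close>, both sides vanish by \<open>zero\<close>.\<close>
      by (intro sum.cong refl) (auto simp: x_def y_def zero)
    finally show ?thesis .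
  qed
  ultimately show ?thesis
    unfolding classical_def mem_Collect_eq using corr d
    by (intro conjI exI[of _ d] exI[of _ "\<lambda>c. u c * u c"] exI[of _ x] exI[of _ y]) auto
qed

section \<open>Quantum correlations\<close>

lemma index_congruence:
  fixes A C :: "complex mat"
  assumes A: "A \<in> carrier_mat d d" and C: "C \<in> carrier_mat d n" and uv: "u < n" "v < n"
  shows "(mat_adjoint C * A * C) $$ (u, v) =
    (\<Sum>j<d. \<Sum>i<d. cnj (C $$ (i, u)) * A $$ (i, j) * C $$ (j, v))"
proof -
  have CA: "mat_adjoint C * A \<in> carrier_mat n d"
    using A C by (intro carrier_matI) auto
  show ?thesis
    unfolding index_mult_mat_sum[OF CA C uv]
  proof (intro sum.cong refl)
    fix j assume "j \<in> {..<d}"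
    then have j: "j < d" by simp
    show "(mat_adjoint C * A) $$ (u, j) * C $$ (j, v) = (\<Sum>i<d. cnj (C $$ (i, u)) * A $$ (i, j) * C $$ (j, v))"
      unfolding index_mult_mat_sum[OF mat_adjoint_carrier[OF C] A uv(1) j] sum_distrib_right
      using C uv by (intro sum.cong refl) simp
  qed
qed

lemma sum_congruence:
  fixes A :: "'k \<Rightarrow> complex mat"
  assumes A: "\<And>k. k \<in> I \<Longrightarrow> A k \<in> carrier_mat d d" and C: "C \<in> carrier_mat d n"
    and uv: "u < n" "v < n"
  shows "(\<Sum>k\<in>I. (mat_adjoint C * A k * C) $$ (u, v)) =
    (mat_adjoint C * Matrix.mat d d (\<lambda>(i, j). \<Sum>k\<in>I. A k $$ (i, j)) * C) $$ (u, v)"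
proof -
  have "(\<Sum>k\<in>I. (mat_adjoint C * A k * C) $$ (u, v)) =
      (\<Sum>k\<in>I. \<Sum>j<d. \<Sum>i<d. cnj (C $$ (i, u)) * A k $$ (i, j) * C $$ (j, v))"
    by (rule sum.cong[OF refl], rule index_congruence[OF A C uv])
  also have "\<dots> = (\<Sum>j<d. \<Sum>k\<in>I. \<Sum>i<d. cnj (C $$ (i, u)) * A k $$ (i, j) * C $$ (j, v))"
    by (rule sum.swap)
  also have "\<dots> = (\<Sum>j<d. \<Sum>i<d. \<Sum>k\<in>I. cnj (C $$ (i, u)) * A k $$ (i, j) * C $$ (j, v))"
    by (intro sum.cong refl sum.swap)
  also have "\<dots> = (mat_adjoint C * Matrix.mat d d (\<lambda>(i, j). \<Sum>k\<in>I. A k $$ (i, j)) * C) $$ (u, v)"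
    by (subst index_congruence[OF _ C uv]) (simp_all add: sum_distrib_left sum_distrib_right)
  finally show ?thesis .
qed

text \<open>Congruence is linear in the effect, and the effects sum to the identity.\<close>

lemma measurement_congruence:
  assumes "measurement d E" and C: "C \<in> carrier_mat d n" and uv: "u < n" "v < n"
  shows "(\<Sum>r\<in>UNIV. (mat_adjoint C * E r * C) $$ (u, v)) = (mat_adjoint C * C) $$ (u, v)"
proof -
  have E: "E r \<in> carrier_mat d d" for r using assms(1) by (simp add: measurement_def)
  have "Matrix.mat d d (\<lambda>(i, j). \<Sum>r\<in>UNIV. E r $$ (i, j)) = 1\<^sub>m d"
    using assms(1) by (simp add: measurement_def)
  then show ?thesis
    unfolding sum_congruence[OF E C uv] by (simp add: right_mult_one_mat[OF mat_adjoint_carrier[OF C]])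
qed

lemma measurement_transpose:
  assumes "measurement d E"
  shows "measurement d (\<lambda>r. transpose_mat (E r))"
proof -
  have E: "psd d (E r)" for r using assms by (simp add: measurement_def)
  have one: "Matrix.mat d d (\<lambda>(i, j). \<Sum>r\<in>UNIV. E r $$ (i, j)) = 1\<^sub>m d"
    using assms by (simp add: measurement_def)
  have "Matrix.mat d d (\<lambda>(i, j). \<Sum>r\<in>UNIV. transpose_mat (E r) $$ (i, j)) =
      transpose_mat (Matrix.mat d d (\<lambda>(i, j). \<Sum>r\<in>UNIV. E r $$ (i, j)))"
    using carrier_matD[OF psd_carrier[OF E]] by (intro eq_matI) auto
  then show ?thesis using E by (simp add: measurement_def psd_transpose one)
qed

text \<open>Nonnegative diagonal entries with sum 0 all vanish, and with them the whole row and
  column. Hence nothing is lost on the kernel of the sum, where inverse roots are replaced by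
  0.\<close>

lemma psd_family_zero:
  fixes M :: "'r::finite \<Rightarrow> complex mat"
  assumes M: "\<And>r. psd d (M r)" and uv: "u < d" "v < d" and 0: "(\<Sum>r\<in>UNIV. M r $$ (u, u)) = 0"
  shows "M r $$ (u, v) = 0" "M r $$ (v, u) = 0"
proof -
  have "\<forall>r\<in>UNIV. M r $$ (u, u) = 0"
    using 0 psd_diag_nonneg[OF M uv(1)] by (subst (asm) sum_nonneg_eq_0_iff) auto
  then show 1: "M r $$ (u, v) = 0" by (intro psd_zero_diag[OF M uv]) simp
  then show "M r $$ (v, u) = 0" using psd_conjugate_entry[OF M uv(2,1), of r] by simp
qed

text \<open>Nonnegativity of the traces is obtained by viewing the real matrices as complex
  ones.\<close>

lemma cpsd_cone_subset_nonneg: "cpsd_cone \<subseteq> nonneg_cone"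
proof
  fix X :: "real ^ 'n ^ 'n" assume "X \<in> cpsd_cone"
  then obtain d and M :: "'n \<Rightarrow> real mat" where M: "\<forall>i. psd d (M i)"
    and X: "X = (\<chi> i j. mat_trace (M i * M j))"
    unfolding cpsd_cone_def mem_Collect_eq by (elim exE conjE)
  have c: "M i \<in> carrier_mat d d" for i using M by simp
  have "0 \<le> mat_trace (M i * M j)" for i j
  proof -
    have "0 \<le> mat_trace (map_mat complex_of_real (M i) * map_mat complex_of_real (M j))"
      using M by (intro mat_trace_psd_mult_nonneg[of d] psd_map_complex_of_real) auto
    then show ?thesis by (simp add: mat_trace_map_complex_of_real[OF c c] less_eq_complex_def)
  qed
  moreover have "mat_trace (M i * M j) = mat_trace (M j * M i)" for i j
    by (rule mat_trace_comm[OF c c])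
  ultimately show "X \<in> nonneg_cone"
    by (simp add: nonneg_cone_def sym_matrices_def Finite_Cartesian_Product.transpose_def X vec_eq_iff)
qed

text \<open>A common block sum \<open>K\<close> gives all block sums of the Gram matrix one and the
  same value, and normalisation of \<open>p\<close> identifies this value as 1. Realification then
  passes from complex to real matrices.\<close>

lemma Corr_cpsdI:
  fixes p :: "('a::finite, 'b::finite, 's::finite, 't::finite) corr"
    and Z :: "('s \<times> 'a) + ('t \<times> 'b) \<Rightarrow> complex mat"
  assumes p: "p \<in> correlations" and Z: "\<And>k. psd m (Z k)"
    and K: "\<And>i u v. u < m \<Longrightarrow> v < m \<Longrightarrow> (\<Sum>k\<in>block i. Z k $$ (u, v)) = K u v"
    and tr: "\<And>a b s t. mat_trace (Z (Inl (s, a)) * Z (Inr (t, b))) = complex_of_real (p a b s t)"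
  shows "p \<in> Corr cpsd_cone"
proof -
  have c: "Z k \<in> carrier_mat m m" for k using Z by simp
  define X where "X = (\<chi> k l. mat_trace (realification (Z k) * realification (Z l)))"
  have X: "X $h k $h l = Re (mat_trace (Z k * Z l))" for k l
    by (simp add: X_def mat_trace_realification[OF c c])
  have bs: "block_sum i j X = Re (\<Sum>u<m. \<Sum>v<m. K u v * K v u)" for i j
    by (simp add: block_sum_def X sum_mat_trace_mult[OF c] K flip: Re_sum)
  have Xp: "X $h Inl (s, a) $h Inr (t, b) = p a b s t" for a b s t by (simp add: X tr)
  have "block_sum (Inl undefined) (Inr undefined) X = 1"
    using p by (simp add: block_sum_Inl_Inr Xp correlations_def)
  then have K1: "Re (\<Sum>u<m. \<Sum>v<m. K u v * K v u) = 1" by (simp only: bs)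
  \<comment> \<open>In dimension 0 the trace would be 0 instead of 1.\<close>
  then have "m + m \<ge> 1" by (cases m) auto
  then have "X \<in> cpsd_cone"
    unfolding cpsd_cone_def X_def using psd_realification[OF Z]
    by (intro CollectI exI[of _ "m + m"] exI[of _ "\<lambda>k. realification (Z k)"] conjI) auto
  then show ?thesis by (rule CorrI) (simp_all only: bs K1 Xp)
qed

section \<open>From a quantum realisation to a completely positive semidefinite matrix\<close>

lemma Corr_cpsd_if_quantum:
  fixes p :: "('a::finite, 'b::finite, 's::finite, 't::finite) corr"
  assumes "p \<in> quantum"
  shows "p \<in> Corr cpsd_cone"
proof -
  from assms obtain m n :: nat and \<psi> :: "complex vec"
    and X :: "'s \<Rightarrow> 'a \<Rightarrow> complex mat" and Y :: "'t \<Rightarrow> 'b \<Rightarrow> complex mat"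
    where corr: "p \<in> correlations" and psi: "\<psi> \<in> carrier_vec (m * n)"
    and X: "\<forall>s. measurement m (X s)" and Y: "\<forall>t. measurement n (Y t)"
    and p: "\<forall>a b s t. complex_of_real (p a b s t) = (kronecker (X s a) (Y t b) *\<^sub>v \<psi>) \<bullet>c \<psi>"
    unfolding quantum_def mem_Collect_eq by (elim conjE exE)
  have Xp: "psd m (X s a)" and Yp: "psd n (Y t b)" for s a t b
    using X Y by (auto simp: measurement_def)
  note Xc = psd_carrier[OF Xp] and Yc = psd_carrier[OF Yp]
  define \<Psi> where "\<Psi> = Matrix.mat m n (\<lambda>(i, j). \<psi> $ (i * n + j))"
  have Psi: "\<Psi> \<in> carrier_mat m n" by (simp add: \<Psi>_def)
  have "psd m (\<Psi> * mat_adjoint \<Psi>)"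
    using psd_congruence[OF psd_one mat_adjoint_carrier[OF Psi]] by (simp add: right_mult_one_mat[OF Psi])
  then obtain V D where V: "V \<in> carrier_mat m m" and VV: "mat_adjoint V * V = 1\<^sub>m m"
    and VV': "V * mat_adjoint V = 1\<^sub>m m" and D: "\<forall>i. 0 \<le> D i"
    and diag: "mat_adjoint V * (\<Psi> * mat_adjoint \<Psi>) * V =
      Matrix.mat m m (\<lambda>(i, j). if i = j then complex_of_real (D i) else 0)"
    using psd_diagonalization[of m "\<Psi> * mat_adjoint \<Psi>"] by blast
  \<comment> \<open>Congruence by \<open>C\<close> carries the second party's operators through
    \<Psi> directly into the eigenbasis of \<open>\<Psi> * mat_adjoint \<Psi>\<close>.\<close>
  define C where "C = mat_adjoint \<Psi> * V"
  have C: "C \<in> carrier_mat n m" unfolding C_def by (rule mult_carrier_mat[OF mat_adjoint_carrier[OF Psi] V])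
  have CAC: "mat_adjoint C * A * C = mat_adjoint V * (\<Psi> * A * mat_adjoint \<Psi>) * V"
    if "A \<in> carrier_mat n n" for A
    unfolding C_def using congruence_mult[OF that mat_adjoint_carrier[OF Psi] V] by simp
  have CC: "mat_adjoint C * C = Matrix.mat m m (\<lambda>(i, j). if i = j then complex_of_real (D i) else 0)"
    using CAC[OF one_carrier_mat] C by (simp add: diag right_mult_one_mat[OF mat_adjoint_carrier[OF C]] right_mult_one_mat[OF Psi])
  define X' where "X' s a = mat_adjoint V * X s a * V" for s a
  define W where "W t b = mat_adjoint C * transpose_mat (Y t b) * C" for t b
  have X'p: "psd m (X' s a)" for s a unfolding X'_def by (rule psd_congruence[OF Xp V])
  have Wp: "psd m (W t b)" for t b unfolding W_def by (rule psd_congruence[OF psd_transpose[OF Yp] C])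
  have sX: "(\<Sum>a\<in>UNIV. X' s a $$ (u, v)) = (if u = v then 1 else 0)" if "u < m" "v < m" for s u v
    unfolding X'_def measurement_congruence[OF X[rule_format] V that] VV using that by simp
  have sW: "(\<Sum>b\<in>UNIV. W t b $$ (u, v)) = (if u = v then complex_of_real (D u) else 0)"
    if "u < m" "v < m" for t u v
    unfolding W_def measurement_congruence[OF measurement_transpose[OF Y[rule_format]] C that] CC
    using that by simp
  \<comment> \<open>The operators \<open>W t b\<close> sum to the diagonal matrix of
    \<open>D\<close>, so each of them vanishes on its kernel.\<close>
  have W0: "W t b $$ (v, u) = 0" if "u < m" "v < m" "D u = 0 \<or> D v = 0" for t b u v
    using psd_family_zero[where M = "W t" and r = b, OF Wp that(1,2)]
      psd_family_zero[where M = "W t" and r = b, OF Wp that(2,1)]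
      sW[OF that(1,1), of t] sW[OF that(2,2), of t] that(3) by auto
  have pXW: "complex_of_real (p a b s t) = (\<Sum>u<m. \<Sum>v<m. X' s a $$ (u, v) * W t b $$ (v, u))" for a b s t
  proof -
    have c: "\<Psi> * transpose_mat (Y t b) * mat_adjoint \<Psi> \<in> carrier_mat m m"
      using Psi Yc[of t b] by (intro carrier_matI) auto
    have "complex_of_real (p a b s t) = mat_trace (X s a * (\<Psi> * transpose_mat (Y t b) * mat_adjoint \<Psi>))"
      unfolding p[rule_format] \<Psi>_def by (rule kronecker_form[OF Xc Yc psi])
    also have "\<dots> = mat_trace (X' s a * W t b)"
      unfolding X'_def W_def using Yc[of t b]
      by (subst CAC) (auto simp: mat_trace_unitary_congruence[OF Xc c V VV'])
    finally show ?thesis unfolding mat_trace_mult[OF psd_carrier[OF X'p] psd_carrier[OF Wp]] .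
  qed
  \<comment> \<open>The common block sum is to be the diagonal matrix of \<open>sqrt (D u)\<close>.
    The first family sums to the identity and is scaled by fourth roots of \<open>D\<close>; the
    second sums to \<open>D\<close> and is scaled by their inverses, with
    \<open>inverse 0 = 0\<close>.\<close>
  define e where "e u = sqrt (sqrt (D u))" for u
  define f where "f u = inverse (e u)" for u
  have ee: "e u * e u = sqrt (D u)" and DD: "sqrt (D u) * sqrt (D u) = D u" for u
    using D by (simp_all add: e_def)
  have e0: "e u = 0 \<longleftrightarrow> D u = 0" for u by (simp add: e_def)
  have ff: "f u * D u * f u = sqrt (D u)" for u
  proof (cases "D u = 0")
    case False
    then have "f u * ((e u * e u) * (e u * e u)) * f u = e u * e u"
      by (simp add: f_def e0)
    then show ?thesis by (simp only: ee DD)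
  qed simp
  define Z :: "('s \<times> 'a) + ('t \<times> 'b) \<Rightarrow> complex mat" where
    "Z k = (case k of
        Inl (s, a) \<Rightarrow> Matrix.mat m m (\<lambda>(u, v). complex_of_real (e u) * X' s a $$ (u, v) * complex_of_real (e v))
      | Inr (t, b) \<Rightarrow> Matrix.mat m m (\<lambda>(u, v). complex_of_real (f u) * W t b $$ (u, v) * complex_of_real (f v)))" for k
  have Z: "psd m (Z k)" for k
    unfolding Z_def by (auto split: sum.splits prod.splits intro!: psd_scale X'p Wp)
  show ?thesis
  proof (rule Corr_cpsdI[OF corr Z])
    fix i :: "'s + 't" and u v assume uv: "u < m" "v < m"
    show "(\<Sum>k\<in>block i. Z k $$ (u, v)) = (if u = v then complex_of_real (sqrt (D u)) else 0)"
    proof (cases i)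
      case (Inl s)
      have "(\<Sum>k\<in>block i. Z k $$ (u, v)) =
          complex_of_real (e u) * (\<Sum>a\<in>UNIV. X' s a $$ (u, v)) * complex_of_real (e v)"
        unfolding Inl sum_block using uv by (simp add: Z_def sum_distrib_left sum_distrib_right)
      then show ?thesis using uv by (simp add: sX ee flip: of_real_mult)
    next
      case (Inr t)
      have "(\<Sum>k\<in>block i. Z k $$ (u, v)) =
          complex_of_real (f u) * (\<Sum>b\<in>UNIV. W t b $$ (u, v)) * complex_of_real (f v)"
        unfolding Inr sum_block using uv by (simp add: Z_def sum_distrib_left sum_distrib_right)
      then show ?thesis using uv by (simp add: sW ff flip: of_real_mult)
    qed
  next
    fix a b s t
    have "mat_trace (Z (Inl (s, a)) * Z (Inr (t, b))) =
        (\<Sum>u<m. \<Sum>v<m. Z (Inl (s, a)) $$ (u, v) * Z (Inr (t, b)) $$ (v, u))"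
      by (rule mat_trace_mult[OF psd_carrier[OF Z] psd_carrier[OF Z]])
    also have "\<dots> = (\<Sum>u<m. \<Sum>v<m. X' s a $$ (u, v) * W t b $$ (v, u))"
    proof (intro sum.cong refl)
      fix u v assume "u \<in> {..<m}" "v \<in> {..<m}"
      then have uv: "u < m" "v < m" by auto
      show "Z (Inl (s, a)) $$ (u, v) * Z (Inr (t, b)) $$ (v, u) = X' s a $$ (u, v) * W t b $$ (v, u)"
      \<comment> \<open>Off the kernel the factors \<open>e\<close> and \<open>f\<close> cancel; on
        it the entry of \<open>W t b\<close> is already 0.\<close>
      proof (cases "D u = 0 \<or> D v = 0")
        case True
        then show ?thesis using uv by (simp add: Z_def W0)
      next
        case False
        then have "e u \<noteq> 0" "e v \<noteq> 0" by (simp_all add: e0)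
        then show ?thesis using uv by (simp add: Z_def f_def field_simps)
      qed
    qed
    finally show "mat_trace (Z (Inl (s, a)) * Z (Inr (t, b))) = complex_of_real (p a b s t)"
      by (simp only: pXW)
  qed
qed

section \<open>From a completely positive semidefinite matrix to a quantum realisation\<close>

lemma inverse_sqrt_sandwich:
  fixes x :: real
  assumes "0 \<le> x"
  shows "inverse (sqrt x) * x * inverse (sqrt x) = (if x = 0 then 0 else 1)"
\<comment> \<open>Since \<open>inverse 0 = 0\<close>, the scaling acts as a pseudo-inverse and
  yields the indicator of the support.\<close>
proof (cases "x = 0")
  case False
  have "inverse y * (y * y) * inverse y = 1" if "y \<noteq> 0" for y :: real
    using that by (simp add: field_simps)
  from this[of "sqrt x"] show ?thesis using False assms by simp
qed simp

(* D^(-1/2) N D^(-1/2) for the diagonal matrix D with the given entries, where a multiple of the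
   projection onto the kernel of D is added to make the effects of a measurement sum to 1. *)
definition normalized_effect :: "nat \<Rightarrow> (nat \<Rightarrow> real) \<Rightarrow> real \<Rightarrow> complex mat \<Rightarrow> complex mat" where
  "normalized_effect d D c N = Matrix.mat d d (\<lambda>(u, v).
     Matrix.mat d d (\<lambda>(u, v). complex_of_real (inverse (sqrt (D u))) * N $$ (u, v) *
       complex_of_real (inverse (sqrt (D v)))) $$ (u, v)
     + (if u = v then complex_of_real (if D u = 0 then 1 / c else 0) else 0))"

text \<open>The rescaled operators sum to the projection onto the support of \<open>D\<close>; each
  outcome adds an equal share of the projection onto the kernel.\<close>

lemma measurement_normalized_effect:
  fixes N :: "'r::finite \<Rightarrow> complex mat"
  assumes N: "\<And>r. psd d (N r)" and D: "\<forall>i. 0 \<le> D i"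
    and sN: "\<And>u v. u < d \<Longrightarrow> v < d \<Longrightarrow> (\<Sum>r\<in>UNIV. N r $$ (u, v)) = (if u = v then complex_of_real (D u) else 0)"
  shows "measurement d (\<lambda>r. normalized_effect d D (real CARD('r)) (N r))"
  unfolding measurement_def
proof (intro conjI allI)
  define f where "f u = inverse (sqrt (D u))" for u
  note E_def = normalized_effect_def[of d D, folded f_def]
  have fDf: "f u * D u * f u = (if D u = 0 then 0 else 1)" for u
    unfolding f_def using D by (intro inverse_sqrt_sandwich) simp
  show "psd d (normalized_effect d D (real CARD('r)) (N r))" for r
    unfolding E_def by (intro psd_add_diag psd_scale N) simp
  show "Matrix.mat d d (\<lambda>(u, v). \<Sum>r\<in>UNIV. normalized_effect d D (real CARD('r)) (N r) $$ (u, v)) = 1\<^sub>m d"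
  proof (rule eq_matI)
    fix u v assume "u < dim_row (1\<^sub>m d :: complex mat)" "v < dim_col (1\<^sub>m d :: complex mat)"
    then have uv: "u < d" "v < d" by auto
    have "(\<Sum>r\<in>UNIV. normalized_effect d D (real CARD('r)) (N r) $$ (u, v)) =
        complex_of_real (f u) * (\<Sum>r\<in>UNIV. N r $$ (u, v)) * complex_of_real (f v)
        + (if u = v then complex_of_real (if D u = 0 then 1 else 0) else 0)"
      using uv by (simp add: E_def sum.distrib sum_distrib_left sum_distrib_right)
    also have "\<dots> = 1\<^sub>m d $$ (u, v)"
      using uv by (simp add: sN fDf flip: of_real_mult)
    finally show "Matrix.mat d d (\<lambda>(u, v). \<Sum>r\<in>UNIV. normalized_effect d D (real CARD('r)) (N r) $$ (u, v)) $$ (u, v)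
        = 1\<^sub>m d $$ (u, v)"
      using uv by simp
  qed auto
qed

lemma quantum_if_Corr_cpsd:
  fixes p :: "('a::finite, 'b::finite, 's::finite, 't::finite) corr"
  assumes "p \<in> Corr cpsd_cone"
  shows "p \<in> quantum"
proof -
  have corr: "p \<in> correlations"
    using assms Corr_mono[OF cpsd_cone_subset_nonneg] correlations_if_Corr_nonneg by blast
  from assms obtain G :: "('a, 'b, 's, 't) bell_matrix" where "G \<in> cpsd_cone"
    and B: "\<And>i j. block_sum i j G = 1" and p: "\<And>a b s t. G $h Inl (s, a) $h Inr (t, b) = p a b s t"
    unfolding Corr_def by blast
  then obtain d and M :: "'s \<times> 'a + 't \<times> 'b \<Rightarrow> real mat" where M: "\<forall>k. psd d (M k)"
    and G: "G = (\<chi> k l. mat_trace (M k * M l))"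
    unfolding cpsd_cone_def mem_Collect_eq by (elim exE conjE)
  have Mc: "M k \<in> carrier_mat d d" for k using M by simp
  have sym: "M k $$ (u, v) = M k $$ (v, u)" if "u < d" "v < d" for k u v
    using psd_conjugate_entry[OF M[rule_format], of v u k] that by simp
  \<comment> \<open>Symmetry of the matrices turns the trace pairing into the entrywise inner
    product, so the block sums can be compared as functions on index pairs.\<close>
  have U: "(\<Sum>x\<in>{..<d} \<times> {..<d}. (\<Sum>k\<in>block i. M k $$ x) * (\<Sum>l\<in>block j. M l $$ x)) = 1" for i j
  proof -
    have "1 = (\<Sum>u<d. \<Sum>v<d. (\<Sum>k\<in>block i. M k $$ (u, v)) * (\<Sum>l\<in>block j. M l $$ (v, u)))"
      using B[of i j] by (simp add: block_sum_def G sum_mat_trace_mult[OF Mc])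
    also have "\<dots> = (\<Sum>u<d. \<Sum>v<d. (\<Sum>k\<in>block i. M k $$ (u, v)) * (\<Sum>l\<in>block j. M l $$ (u, v)))"
      by (intro sum.cong refl arg_cong2[where f = "(*)"] sym) auto
    finally show ?thesis by (simp add: sum.cartesian_product)
  qed
  define A where "A k = map_mat complex_of_real (M k)" for k
  have Ap: "psd d (A k)" for k unfolding A_def using M by (intro psd_map_complex_of_real) simp
  \<comment> \<open>The common block sum, computed from an arbitrarily chosen block.\<close>
  define U0 where "U0 = Matrix.mat d d (\<lambda>(u, v). \<Sum>k\<in>block (Inl undefined). A k $$ (u, v))"
  have U0: "Matrix.mat d d (\<lambda>(u, v). \<Sum>k\<in>block i. A k $$ (u, v)) = U0" for i
  proof (unfold U0_def, rule eq_matI)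
    fix u v
    assume "u < dim_row (Matrix.mat d d (\<lambda>(u, v). \<Sum>k\<in>block (Inl undefined). A k $$ (u, v)))"
      "v < dim_col (Matrix.mat d d (\<lambda>(u, v). \<Sum>k\<in>block (Inl undefined). A k $$ (u, v)))"
    then have uv: "u < d" "v < d" by auto
    have "(\<Sum>k\<in>block i. M k $$ (u, v)) = (\<Sum>k\<in>block (Inl undefined). M k $$ (u, v))"
      by (rule eq_if_sum_products_eq[OF _ U U U]) (use uv in auto)
    then have "(\<Sum>k\<in>block i. A k $$ (u, v)) = (\<Sum>k\<in>block (Inl undefined). A k $$ (u, v))"
      using uv Mc by (simp add: A_def carrier_matD[OF Mc] flip: of_real_sum)
    then show "Matrix.mat d d (\<lambda>(u, v). \<Sum>k\<in>block i. A k $$ (u, v)) $$ (u, v) =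
        Matrix.mat d d (\<lambda>(u, v). \<Sum>k\<in>block (Inl undefined). A k $$ (u, v)) $$ (u, v)"
      using uv by simp
  qed auto
  have "psd d U0" unfolding U0_def by (rule psd_sum) (auto simp: Ap)
  then obtain V D where V: "V \<in> carrier_mat d d" and VV': "V * mat_adjoint V = 1\<^sub>m d"
    and D: "\<forall>i. 0 \<le> D i"
    and diag: "mat_adjoint V * U0 * V = Matrix.mat d d (\<lambda>(i, j). if i = j then complex_of_real (D i) else 0)"
    using psd_diagonalization[of d U0] by blast
  define Z where "Z k = mat_adjoint V * A k * V" for k
  have Zp: "psd d (Z k)" for k unfolding Z_def by (rule psd_congruence[OF Ap V])
  have sZ: "(\<Sum>k\<in>block i. Z k $$ (u, v)) = (if u = v then complex_of_real (D u) else 0)"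
    if "u < d" "v < d" for i u v
    unfolding Z_def sum_congruence[OF psd_carrier[OF Ap] V that] U0 diag using that by simp
  have trZ: "mat_trace (Z k * Z l) = complex_of_real (G $h k $h l)" for k l
    unfolding Z_def mat_trace_unitary_congruence[OF psd_carrier[OF Ap] psd_carrier[OF Ap] V VV']
    by (simp add: A_def mat_trace_map_complex_of_real[OF Mc Mc] G)
  \<comment> \<open>The trace of the square of the common block sum is a block sum of
    \<open>G\<close>; this makes the state below a unit vector.\<close>
  have DD: "(\<Sum>u<d. D u * D u) = 1"
  proof -
    have "complex_of_real 1 = (\<Sum>k\<in>block (Inl undefined). \<Sum>l\<in>block (Inl undefined). mat_trace (Z k * Z l))"
      using B[of "Inl undefined" "Inl undefined"] by (simp add: trZ block_sum_def flip: of_real_sum)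
    also have "\<dots> = (\<Sum>u<d. \<Sum>v<d. if u = v then complex_of_real (D u * D u) else 0)"
      unfolding sum_mat_trace_mult[OF psd_carrier[OF Zp]]
      by (intro sum.cong refl) (auto simp: sZ simp del: block.simps)
    also have "\<dots> = complex_of_real (\<Sum>u<d. D u * D u)" by simp
    finally show ?thesis using of_real_eq_iff by metis
  qed
  define f where "f u = inverse (sqrt (D u))" for u
  note E_def = normalized_effect_def[of d D, folded f_def]
  have fDf: "f u * D u * f u = (if D u = 0 then 0 else 1)" for u
    unfolding f_def using D by (intro inverse_sqrt_sandwich) simp
  define X where "X s a = normalized_effect d D (real CARD('a)) (Z (Inl (s, a)))" for s a
  \<comment> \<open>The transpose undoes the one that \<open>kronecker_form\<close> introduces on
    the second factor.\<close>
  define Y where "Y t b = transpose_mat (normalized_effect d D (real CARD('b)) (Z (Inr (t, b))))" for t b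
  have X: "measurement d (X s)" for s
    unfolding X_def by (rule measurement_normalized_effect[OF Zp D]) (use sZ[of _ _ "Inl s"] in \<open>simp only: sum_block\<close>)
  have Y: "measurement d (Y t)" for t
    unfolding Y_def by (rule measurement_transpose, rule measurement_normalized_effect[OF Zp D]) (use sZ[of _ _ "Inr t"] in \<open>simp only: sum_block\<close>)
  \<comment> \<open>The diagonal matrix of \<open>D\<close> flattened row by row: the sum of
    \<open>D i\<close> times the i-th basis vector tensored with itself.\<close>
  define \<psi> where "\<psi> = Matrix.vec (d * d) (\<lambda>q. if q div d = q mod d then complex_of_real (D (q mod d)) else 0)"
  have psi: "\<psi> \<in> carrier_vec (d * d)" by (simp add: \<psi>_def)
  have psi_nth: "\<psi> $ (i * d + j) = (if i = j then complex_of_real (D i) else 0)" if "i < d" "j < d" for i j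
    using that pair_index_less[OF that] by (simp add: \<psi>_def)
  have psi1: "\<psi> \<bullet>c \<psi> = 1"
  proof -
    have "\<psi> \<bullet>c \<psi> = (\<Sum>q<d * d. \<psi> $ q * cnj (\<psi> $ q))"
      using psi by (simp add: scalar_prod_def atLeast0LessThan)
    also have "\<dots> = (\<Sum>i<d. \<Sum>j<d. if i = j then complex_of_real (D i * D i) else 0)"
      unfolding sum_lessThan_times by (intro sum.cong refl) (simp add: psi_nth)
    also have "\<dots> = complex_of_real (\<Sum>i<d. D i * D i)" by simp
    finally show ?thesis by (simp only: DD of_real_1)
  qed
  define \<Delta> where "\<Delta> = Matrix.mat d d (\<lambda>(i, j). if i = j then complex_of_real (D i) else 0)"
  have \<Delta>: "\<Delta> \<in> carrier_mat d d" and \<Delta>_adjoint: "mat_adjoint \<Delta> = \<Delta>"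
    by (auto simp: \<Delta>_def intro!: eq_matI)
  have index_\<Delta>: "(mat_adjoint \<Delta> * N * \<Delta>) $$ (u, v) = complex_of_real (D u) * N $$ (u, v) * complex_of_real (D v)"
    if N: "N \<in> carrier_mat d d" and uv: "u < d" "v < d" for N u v
  proof -
    have "(mat_adjoint \<Delta> * N * \<Delta>) $$ (u, v) = (\<Sum>j<d. \<Sum>i<d.
        if i = u then if j = v then complex_of_real (D u) * N $$ (u, v) * complex_of_real (D v) else 0 else 0)"
      unfolding index_congruence[OF N \<Delta> uv]
      by (intro sum.cong refl) (use uv in \<open>auto simp: \<Delta>_def\<close>)
    then show ?thesis using uv by simp
  qed
  have "complex_of_real (p a b s t) = (kronecker (X s a) (Y t b) *\<^sub>v \<psi>) \<bullet>c \<psi>" for a b s t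
  proof -
    have c: "X s a \<in> carrier_mat d d" "Y t b \<in> carrier_mat d d"
      using X Y by (auto simp: measurement_def)
    define N where "N = normalized_effect d D (real CARD('b)) (Z (Inr (t, b)))"
    have N: "N \<in> carrier_mat d d" by (simp add: N_def E_def)
    have "Matrix.mat d d (\<lambda>(i, j). \<psi> $ (i * d + j)) = \<Delta>"
      by (rule eq_matI) (auto simp: psi_nth \<Delta>_def)
    then have "(kronecker (X s a) (Y t b) *\<^sub>v \<psi>) \<bullet>c \<psi> = mat_trace (X s a * (mat_adjoint \<Delta> * N * \<Delta>))"
      unfolding kronecker_form[OF c psi] by (simp add: Y_def N_def \<Delta>_adjoint)
    also have "\<dots> = (\<Sum>u<d. \<Sum>v<d. X s a $$ (u, v) * (mat_adjoint \<Delta> * N * \<Delta>) $$ (v, u))"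
      by (rule mat_trace_mult[OF c(1)]) (use \<Delta> in \<open>auto intro!: carrier_matI\<close>)
    also have "\<dots> = (\<Sum>u<d. \<Sum>v<d. Z (Inl (s, a)) $$ (u, v) * Z (Inr (t, b)) $$ (v, u))"
    proof (intro sum.cong refl)
      fix u v assume "u \<in> {..<d}" "v \<in> {..<d}"
      then have uv: "u < d" "v < d" by auto
      have "X s a $$ (u, v) * (mat_adjoint \<Delta> * N * \<Delta>) $$ (v, u) =
          X s a $$ (u, v) * (complex_of_real (D v) * N $$ (v, u) * complex_of_real (D u))"
        by (simp only: index_\<Delta>[OF N uv(2,1)])
      also have "\<dots> = Z (Inl (s, a)) $$ (u, v) * Z (Inr (t, b)) $$ (v, u)"
      \<comment> \<open>On the kernel \<open>X s a\<close> may contain the added projection, but a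
        factor \<open>D\<close> kills the left side, and the entry of \<open>Z\<close> kills the
        right side. Off the kernel nothing was added, and the scalings cancel against
        \<open>D u\<close> and \<open>D v\<close>.\<close>
      proof (cases "D u = 0 \<or> D v = 0")
        case True
        have "(\<Sum>a\<in>UNIV. Z (Inl (s, a)) $$ (w, w)) = complex_of_real (D w)" if "w < d" for w
          using sZ[OF that that, of "Inl s"] by (simp only: sum_block) simp
        then have "Z (Inl (s, a)) $$ (u, v) = 0"
          using True psd_family_zero(1)[where M = "\<lambda>a. Z (Inl (s, a))" and r = a, OF Zp uv]
            psd_family_zero(2)[where M = "\<lambda>a. Z (Inl (s, a))" and r = a, OF Zp uv(2,1)] uv by auto
        then show ?thesis using True by auto
      next
        case False
        then have "X s a $$ (u, v) * (complex_of_real (D v) * N $$ (v, u) * complex_of_real (D u)) =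
            complex_of_real (f u * D u * f u) * complex_of_real (f v * D v * f v) *
            (Z (Inl (s, a)) $$ (u, v) * Z (Inr (t, b)) $$ (v, u))"
          using uv by (simp add: X_def N_def E_def)
        then show ?thesis using False by (simp add: fDf)
      qed
      finally show "X s a $$ (u, v) * (mat_adjoint \<Delta> * N * \<Delta>) $$ (v, u) =
          Z (Inl (s, a)) $$ (u, v) * Z (Inr (t, b)) $$ (v, u)" .
    qed
    also have "\<dots> = mat_trace (Z (Inl (s, a)) * Z (Inr (t, b)))"
      by (rule mat_trace_mult[OF psd_carrier[OF Zp] psd_carrier[OF Zp], symmetric])
    finally show ?thesis by (simp add: trZ p)
  qed
  then show ?thesis
    unfolding quantum_def mem_Collect_eq using corr psi psi1 X Y
    by (intro conjI exI[of _ d] exI[of _ \<psi>] exI[of _ X] exI[of _ Y]) auto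
qed

theorem mainTheorem1:
  fixes p :: "('a::finite, 'b::finite, 's::finite, 't::finite) corr"
  shows "(p \<in> classical \<longleftrightarrow> p \<in> Corr cp_cone) \<and>
         (p \<in> quantum \<longleftrightarrow> p \<in> Corr cpsd_cone) \<and>
         (p \<in> no_signaling \<longleftrightarrow> p \<in> Corr nso_cone) \<and>
         (p \<in> correlations \<longleftrightarrow> p \<in> Corr nonneg_cone)"
  using Corr_cp_if_classical classical_if_Corr_cp Corr_cpsd_if_quantum quantum_if_Corr_cpsd
    no_signaling_iff_Corr correlations_iff_Corr by blast

end
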